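(* For a convex domain $\Omega$ in $\mathbb{R}^n$, $n\ge 3$, the following are equivalent. (a) $\Omega$ is complete hyperbolic. (b) $\Omega$ is hyperbolic. (c) $\Omega$ is weakly hyperbolic. (d) $\Omega$ does not contain any affine $2$-plane. (e) $\Omega$ does not contain any parabolic minimal surface.
   Context: A domain is a nonempty connected open set. A map $f$ from a conformal surface to $\mathbb{R}^n$ is conformal if in any local isothermal coordinates $(x,y)$ it satisfies $f_x\cdot f_y=0$ and $|f_x|=|f_y|$; branch points (points where $df=0$) are allowed. Hyperbolicity: let $\mathbb{D}=\{z\in\mathbb{C}:|z|<1\}$ with coordinate $z=x+iy$, and let $\Omega$ be a domain in $\mathbb{R}^n$, $n\ge 3$. Let $\mathrm{CH}(\mathbb{D},\Omega)$ denote the set of conformal harmonic maps $f:\mathbb{D}\to\Omega$ (possibly with branch points). The minimal pseudometric of $\Omega$ at $p\in\Omega$ on $v\in\mathbb{R}^n$ is $$g_\Omega(p,v)=\inf\{1/r>0:\ \exists f\in \mathrm{CH}(\mathbb{D},\Omega),\ f(0)=p,\ f_x(0)=rv\}\ge 0,$$ and $\mathrm{dist}_\Omega:\Omega\times\Omega\to[0,+\infty)$ is the pseudodistance obtained by integrating $g_\Omega$, i.e., $\mathrm{dist}_\Omega(p,q)$ is the infimum of $\int_0^1 g_\Omega(\gamma(t),\dot\gamma(t))\,dt$ over piecewise $\mathscr{C}^1$ paths $\gamma:[0,1]\to\Omega$ from $p$ to $q$. The domain $\Omega$ is hyperbolic if $\mathrm{dist}_\Omega$ is a distance function (i.e.,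 $\mathrm{dist}_\Omega(p,q)>0$ whenever $p\ne q$), and it is complete hyperbolic if $(\Omega,\mathrm{dist}_\Omega)$ is a complete metric space. The domain $\Omega$ is weakly hyperbolic if every conformal harmonic map $\mathbb{C}\to\Omega$ is constant. Parabolicity: a connected conformal surface $R$ is parabolic if every negative subharmonic function on $R$ is constant. A domain $\Omega\subset\mathbb{R}^n$ does not contain any parabolic minimal surface if every conformal harmonic map $R\to\Omega$ from a parabolic conformal surface $R$ is constant. *)

theory Defs
  imports "HOL-Analysis.Analysis"
begin

section \<open>Conformal harmonic maps from plane domains\<close>

definition partial_x :: "(complex \<Rightarrow> 'b::real_normed_vector) \<Rightarrow> complex \<Rightarrow> 'b"
  where "partial_x f z = frechet_derivative f (at z) 1"

definition partial_y :: "(complex \<Rightarrow> 'b::real_normed_vector) \<Rightarrow> complex \<Rightarrow> 'b"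
  where "partial_y f z = frechet_derivative f (at z) \<i>"

definition C1_on :: "complex set \<Rightarrow> (complex \<Rightarrow> 'b::real_normed_vector) \<Rightarrow> bool"
  where "C1_on D f \<longleftrightarrow>
    (\<forall>z\<in>D. f differentiable (at z)) \<and> continuous_on D (partial_x f) \<and> continuous_on D (partial_y f)"

definition C2_on :: "complex set \<Rightarrow> (complex \<Rightarrow> 'b::real_normed_vector) \<Rightarrow> bool"
  where "C2_on D f \<longleftrightarrow> C1_on D f \<and> C1_on D (partial_x f) \<and> C1_on D (partial_y f)"

definition harmonic_map_on :: "complex set \<Rightarrow> (complex \<Rightarrow> 'b::real_normed_vector) \<Rightarrow> bool"
  where "harmonic_map_on D f \<longleftrightarrow>
    C2_on D f \<and> (\<forall>z\<in>D. partial_x (partial_x f) z + partial_y (partial_y f) z = 0)"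

text \<open>Branch points, where both partial derivatives vanish, are allowed.\<close>

definition conformal_map_on :: "complex set \<Rightarrow> (complex \<Rightarrow> 'b::real_inner) \<Rightarrow> bool"
  where "conformal_map_on D f \<longleftrightarrow>
    (\<forall>z\<in>D. partial_x f z \<bullet> partial_y f z = 0 \<and> norm (partial_x f z) = norm (partial_y f z))"

definition conformal_harmonic_on :: "complex set \<Rightarrow> (complex \<Rightarrow> 'b::real_inner) \<Rightarrow> bool"
  where "conformal_harmonic_on D f \<longleftrightarrow> harmonic_map_on D f \<and> conformal_map_on D f"

definition CH :: "complex set \<Rightarrow> 'b::real_inner set \<Rightarrow> (complex \<Rightarrow> 'b) set"
  where "CH D \<Omega> = {f. conformal_harmonic_on D f \<and> f ` D \<subseteq> \<Omega>}"

section \<open>The minimal pseudometric and hyperbolicity\<close>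

definition minimal_metric :: "'b::real_inner set \<Rightarrow> 'b \<Rightarrow> 'b \<Rightarrow> ennreal"
  where "minimal_metric \<Omega> p v =
    Inf {ennreal (1 / r) | r. r > 0 \<and> (\<exists>f \<in> CH (ball 0 1) \<Omega>. f 0 = p \<and> partial_x f 0 = r *\<^sub>R v)}"

text \<open>Piecewise \<open>C\<^sup>1\<close> in the classical sense: continuously differentiable, with one-sided
  derivatives at the end points, on each closed interval of a partition of \<open>[0,1]\<close>. The library's
  \<^const>\<open>piecewise_C1_differentiable_on\<close> is weaker, since it imposes only continuity at the
  partition points, near which the derivative may be unbounded.\<close>

definition piecewise_C1_path :: "(real \<Rightarrow> 'b::real_normed_vector) \<Rightarrow> bool"
  where "piecewise_C1_path \<gamma> \<longleftrightarrow>
    (\<exists>S. finite S \<and> {0, 1} \<subseteq> S \<and> S \<subseteq> {0..1} \<and>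
      (\<forall>a\<in>S. \<forall>b\<in>S. a < b \<and> S \<inter> {a<..<b} = {} \<longrightarrow>
        (\<exists>\<gamma>'. continuous_on {a..b} \<gamma>' \<and>
          (\<forall>t\<in>{a..b}. (\<gamma> has_vector_derivative \<gamma>' t) (at t within {a..b})))))"

text \<open>At the finitely many break points \<^term>\<open>vector_derivative \<gamma> (at t)\<close> is arbitrary, which does
  not affect the integral.\<close>

definition minimal_length :: "'b::real_inner set \<Rightarrow> (real \<Rightarrow> 'b) \<Rightarrow> ennreal"
  where "minimal_length \<Omega> \<gamma> =
    (\<integral>\<^sup>+t\<in>{0..1}. minimal_metric \<Omega> (\<gamma> t) (vector_derivative \<gamma> (at t)) \<partial>lborel)"

text \<open>For a domain of dimension at least two and points \<open>p, q\<close> in it the infimum is finite, so the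
  conversion to a real number loses nothing.\<close>

definition minimal_dist :: "'b::real_inner set \<Rightarrow> 'b \<Rightarrow> 'b \<Rightarrow> real"
  where "minimal_dist \<Omega> p q =
    enn2real (Inf {minimal_length \<Omega> \<gamma> | \<gamma>.
      piecewise_C1_path \<gamma> \<and> \<gamma> ` {0..1} \<subseteq> \<Omega> \<and> \<gamma> 0 = p \<and> \<gamma> 1 = q})"

definition hyperbolic :: "'b::real_inner set \<Rightarrow> bool"
  where "hyperbolic \<Omega> \<longleftrightarrow> Metric_space \<Omega> (minimal_dist \<Omega>)"

definition complete_hyperbolic :: "'b::real_inner set \<Rightarrow> bool"
  where "complete_hyperbolic \<Omega> \<longleftrightarrow>
    Metric_space \<Omega> (minimal_dist \<Omega>) \<and> Metric_space.mcomplete \<Omega> (minimal_dist \<Omega>)"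

definition weakly_hyperbolic :: "'b::real_inner set \<Rightarrow> bool"
  where "weakly_hyperbolic \<Omega> \<longleftrightarrow> (\<forall>f \<in> CH UNIV \<Omega>. f constant_on UNIV)"

section \<open>Conformal surfaces\<close>

text \<open>A conformal surface is a Hausdorff, second countable space \<open>X\<close> with an atlas \<open>A\<close> of isothermal
  charts \<open>(U, \<phi>)\<close>; \<open>\<phi>\<close> matters only on \<open>U\<close>. The transition maps are locally holomorphic or
  antiholomorphic, so the surface need be neither oriented nor orientable.\<close>

definition conformal_surface :: "'s topology \<Rightarrow> ('s set \<times> ('s \<Rightarrow> complex)) set \<Rightarrow> bool"
  where "conformal_surface X A \<longleftrightarrow>
    Hausdorff_space X \<and> second_countable X \<and>
    (\<Union>(U, \<phi>)\<in>A. U) = topspace X \<and>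
    (\<forall>(U, \<phi>)\<in>A. openin X U \<and> open (\<phi> ` U) \<and>
      homeomorphic_map (subtopology X U) (top_of_set (\<phi> ` U)) \<phi>) \<and>
    (\<forall>(U, \<phi>)\<in>A. \<forall>(V, \<psi>)\<in>A. \<forall>z \<in> \<phi> ` (U \<inter> V).
      (\<psi> \<circ> inv_into U \<phi>) analytic_on {z} \<or> (cnj \<circ> \<psi> \<circ> inv_into U \<phi>) analytic_on {z})"

definition conformal_harmonic_surface ::
    "('s set \<times> ('s \<Rightarrow> complex)) set \<Rightarrow> ('s \<Rightarrow> 'b::real_inner) \<Rightarrow> bool"
  where "conformal_harmonic_surface A F \<longleftrightarrow>
    (\<forall>(U, \<phi>)\<in>A. conformal_harmonic_on (\<phi> ` U) (F \<circ> inv_into U \<phi>))"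

section \<open>Subharmonic functions and parabolicity\<close>

text \<open>The mean of \<open>u\<close> over a circle is the integral of the positive part minus that of the negative
  part. For upper semicontinuous \<open>u < \<infinity>\<close> the former is finite, so the difference is
  well defined, with value \<open>-\<infinity>\<close> allowed.\<close>

definition circle_mean :: "(complex \<Rightarrow> ereal) \<Rightarrow> complex \<Rightarrow> real \<Rightarrow> ereal"
  where "circle_mean u a r = ereal (1 / (2 * pi)) *
    (enn2ereal (\<integral>\<^sup>+t\<in>{0..2*pi}. e2ennreal (u (a + of_real r * cis t)) \<partial>lborel) -
     enn2ereal (\<integral>\<^sup>+t\<in>{0..2*pi}. e2ennreal (- u (a + of_real r * cis t)) \<partial>lborel))"

definition subharmonic_on :: "complex set \<Rightarrow> (complex \<Rightarrow> ereal) \<Rightarrow> bool"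
  where "subharmonic_on D u \<longleftrightarrow>
    (\<forall>z\<in>D. u z < \<infinity>) \<and>
    (\<forall>c. openin (top_of_set D) {z \<in> D. u z < c}) \<and>
    (\<forall>a r. r > 0 \<and> cball a r \<subseteq> D \<longrightarrow> u a \<le> circle_mean u a r)"

definition subharmonic_surface :: "('s set \<times> ('s \<Rightarrow> complex)) set \<Rightarrow> ('s \<Rightarrow> ereal) \<Rightarrow> bool"
  where "subharmonic_surface A u \<longleftrightarrow>
    (\<forall>(U, \<phi>)\<in>A. subharmonic_on (\<phi> ` U) (u \<circ> inv_into U \<phi>))"

definition parabolic_surface :: "'s topology \<Rightarrow> ('s set \<times> ('s \<Rightarrow> complex)) set \<Rightarrow> bool"
  where "parabolic_surface X A \<longleftrightarrow>
    conformal_surface X A \<and> connected_space X \<and>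
    (\<forall>u. subharmonic_surface A u \<and> (\<forall>x\<in>topspace X. u x < 0) \<longrightarrow> u constant_on topspace X)"

text \<open>The surfaces considered have their points in the type \<open>'s\<close>. A nonempty surface has at least
  the cardinality of the continuum, so only types \<open>'s\<close> into which \<^typ>\<open>complex\<close> embeds
  are of interest.\<close>

definition no_parabolic_minimal_surface :: "'s itself \<Rightarrow> 'b::real_inner set \<Rightarrow> bool"
  where "no_parabolic_minimal_surface TYPE('s) \<Omega> \<longleftrightarrow>
    (\<forall>(X :: 's topology) A F. parabolic_surface X A \<and> conformal_harmonic_surface A F \<and>
      F ` topspace X \<subseteq> \<Omega> \<longrightarrow> F constant_on topspace X)"

end

theory Submission
  imports Defs "HOL-Complex_Analysis.Complex_Analysis"
begin

text \<open>Throughout, a linear functional \<open>a\<close> with \<open>a \<bullet> x < b\<close> on \<open>\<Omega>\<close> plays the role of a supporting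
  half space. If \<open>f\<close> is a harmonic map into \<open>\<Omega>\<close>, then \<open>b - a \<bullet> f\<close> is a positive harmonic function,
  and everything that obstructs maps into \<open>\<Omega>\<close> comes from this one observation. The second
  ingredient is conformality, which supplies control in the direction in which there is no half
  space. Since \<open>\<Omega>\<close> is open and convex, every plane \<open>p + span {v, w}\<close> with \<open>p \<in> \<Omega>\<close> on which all
  these functionals are constant lies in \<open>\<Omega>\<close>; so if \<open>\<Omega>\<close> contains no affine plane, the common kernel of the
  functionals is at most a line, and a conformal pair (two orthogonal vectors of equal length) in it
  is zero (\<open>conformal_pair_orthogonal_to_bounded_functionals\<close>).

  \<^bold>\<open>No plane implies complete hyperbolic.\<close> The Schwarz lemma bounds the gradient of a positive harmonic
  function \<open>u\<close> on the disc by \<open>2 u 0\<close>. Applied to one functional it says that the metric dominates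
  half of \<open>d log (b - a \<bullet> x)\<close>, so that boundary points are infinitely far away. Applied to finitely many
  functionals spanning all of them, together with compactness of the set of conformal pairs, it gives
  \<open>g(x, v) \<ge> c \<bar>v\<bar> / (1 + \<bar>x - p\<bar>)\<close> (\<open>minimal_metric_ge_linear_growth\<close>), hence the distance to \<open>p\<close>
  dominates a multiple of \<open>log (1 + \<bar>x - p\<bar>\<^sup>2)\<close>: it separates points, and sets bounded for it are
  bounded in the Euclidean sense. A Cauchy sequence therefore has a Euclidean limit point,
  which is not on the boundary, and near it the distance is controlled by the Euclidean one through
  flat discs.

  \<^bold>\<open>No plane implies no parabolic minimal surface.\<close> On a parabolic surface the negative harmonic functions
  \<open>a \<bullet> F - b\<close> are constant, so the partial derivatives of \<open>F\<close> form a conformal pair in the common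
  kernel and vanish.

  \<^bold>\<open>The converses.\<close> The complex plane is a parabolic surface, by the maximum principle with a
  logarithmic barrier, so the absence of parabolic minimal surfaces
  implies weak hyperbolicity. A plane in \<open>\<Omega>\<close> contains the image of a nonconstant linear conformal map
  of the complex plane, and contains flat discs of every radius, along which the metric vanishes.\<close>

section \<open>Partial derivatives of maps from plane domains\<close>

lemma partials_eq:
  assumes "(f has_derivative L) (at z)"
  shows "partial_x f z = L 1" "partial_y f z = L \<i>"
  using frechet_derivative_at[OF assms] by (simp_all add: partial_x_def partial_y_def)

lemma has_derivative_partials:
  assumes "f differentiable (at z)"
  shows "(f has_derivative (\<lambda>h. Re h *\<^sub>R partial_x f z + Im h *\<^sub>R partial_y f z)) (at z)"
proof -
  let ?L = "frechet_derivative f (at z)"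
  have L: "(f has_derivative ?L) (at z)"
    using assms frechet_derivative_works by blast
  then interpret bounded_linear ?L by (rule has_derivative_bounded_linear)
  have "?L = (\<lambda>h. Re h *\<^sub>R partial_x f z + Im h *\<^sub>R partial_y f z)"
  proof
    fix h
    have "h = Re h *\<^sub>R 1 + Im h *\<^sub>R \<i>" by (simp add: complex_eq_iff)
    then have "?L h = ?L (Re h *\<^sub>R 1 + Im h *\<^sub>R \<i>)" by simp
    then show "?L h = Re h *\<^sub>R partial_x f z + Im h *\<^sub>R partial_y f z"
      by (simp add: add scaleR partial_x_def partial_y_def)
  qed
  with L show ?thesis by metis
qed

lemma C1_onD:
  assumes "C1_on D f" "z \<in> D"
  shows "(f has_derivative (\<lambda>h. Re h *\<^sub>R partial_x f z + Im h *\<^sub>R partial_y f z)) (at z)"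
  using assms has_derivative_partials by (auto simp: C1_on_def)

lemma C1_on_imp_continuous_on: "C1_on D f \<Longrightarrow> continuous_on D f"
  by (meson C1_on_def continuous_at_imp_continuous_on differentiable_imp_continuous_within)

lemma C1_onI:
  assumes "\<And>z. z \<in> D \<Longrightarrow> (f has_derivative (\<lambda>h. Re h *\<^sub>R fx z + Im h *\<^sub>R fy z)) (at z)"
    and "continuous_on D fx" "continuous_on D fy"
  shows "C1_on D f" "\<And>z. z \<in> D \<Longrightarrow> partial_x f z = fx z" "\<And>z. z \<in> D \<Longrightarrow> partial_y f z = fy z"
proof -
  show x: "partial_x f z = fx z" if "z \<in> D" for z using partials_eq(1)[OF assms(1)[OF that]] by simp
  show y: "partial_y f z = fy z" if "z \<in> D" for z using partials_eq(2)[OF assms(1)[OF that]] by simp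
  have "continuous_on D (partial_x f)" "continuous_on D (partial_y f)"
    using assms(2,3) x y by (metis continuous_on_cong)+
  then show "C1_on D f" using assms(1) by (auto simp: C1_on_def differentiable_def)
qed

lemma C1_on_cong:
  assumes "open D" "C1_on D g" and "\<And>z. z \<in> D \<Longrightarrow> f z = g z"
  shows "C1_on D f" "\<And>z. z \<in> D \<Longrightarrow> partial_x f z = partial_x g z"
    "\<And>z. z \<in> D \<Longrightarrow> partial_y f z = partial_y g z"
proof -
  have "(f has_derivative (\<lambda>h. Re h *\<^sub>R partial_x g z + Im h *\<^sub>R partial_y g z)) (at z)" if "z \<in> D" for z
    using has_derivative_transform_within_open[OF C1_onD[OF assms(2) that] assms(1) that] assms(3)
    by auto
  from C1_onI[OF this] show "C1_on D f" "\<And>z. z \<in> D \<Longrightarrow> partial_x f z = partial_x g z"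
    "\<And>z. z \<in> D \<Longrightarrow> partial_y f z = partial_y g z"
    using assms(2) by (auto simp: C1_on_def)
qed

text \<open>The operators \<^const>\<open>partial_x\<close> and \<^const>\<open>partial_y\<close> have arbitrary values where the map is not
  differentiable, so iterated ones can be computed only through maps that agree with the first
  partials on an open set. This rule hides that bookkeeping.\<close>

lemma C2_onI:
  assumes "open D"
    and "\<And>z. z \<in> D \<Longrightarrow> (f has_derivative (\<lambda>h. Re h *\<^sub>R fx z + Im h *\<^sub>R fy z)) (at z)"
    and "C1_on D fx" "C1_on D fy"
  shows "C2_on D f"
    and "\<And>z. z \<in> D \<Longrightarrow> partial_x (partial_x f) z = partial_x fx z"
    and "\<And>z. z \<in> D \<Longrightarrow> partial_y (partial_y f) z = partial_y fy z"
proof -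
  note f = C1_onI[OF assms(2) C1_on_imp_continuous_on[OF assms(3)] C1_on_imp_continuous_on[OF assms(4)]]
  note x = C1_on_cong[OF assms(1,3) f(2)]
  note y = C1_on_cong[OF assms(1,4) f(3)]
  show "C2_on D f" using f(1) x(1) y(1) by (auto simp: C2_on_def)
  show "\<And>z. z \<in> D \<Longrightarrow> partial_x (partial_x f) z = partial_x fx z" using x by blast
  show "\<And>z. z \<in> D \<Longrightarrow> partial_y (partial_y f) z = partial_y fy z" using y by blast
qed

lemma C1_on_bounded_linear:
  assumes "bounded_linear l" "C1_on D f"
  shows "C1_on D (\<lambda>z. l (f z) + c)"
    and "\<And>z. z \<in> D \<Longrightarrow> partial_x (\<lambda>z. l (f z) + c) z = l (partial_x f z)"
    and "\<And>z. z \<in> D \<Longrightarrow> partial_y (\<lambda>z. l (f z) + c) z = l (partial_y f z)"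
proof -
  interpret bounded_linear l by fact
  have "((\<lambda>z. l (f z) + c) has_derivative (\<lambda>h. Re h *\<^sub>R l (partial_x f z) + Im h *\<^sub>R l (partial_y f z))) (at z)"
    if "z \<in> D" for z
    using has_derivative_add[OF has_derivative[OF C1_onD[OF assms(2) that]] has_derivative_const[of c]]
    by (simp add: add scaleR)
  moreover have "continuous_on D (\<lambda>z. l (partial_x f z))" "continuous_on D (\<lambda>z. l (partial_y f z))"
    using assms(2) by (auto simp: C1_on_def intro!: continuous_on)
  ultimately show "C1_on D (\<lambda>z. l (f z) + c)"
    "\<And>z. z \<in> D \<Longrightarrow> partial_x (\<lambda>z. l (f z) + c) z = l (partial_x f z)"
    "\<And>z. z \<in> D \<Longrightarrow> partial_y (\<lambda>z. l (f z) + c) z = l (partial_y f z)"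
    using C1_onI[of D "\<lambda>z. l (f z) + c" "\<lambda>z. l (partial_x f z)" "\<lambda>z. l (partial_y f z)"] by blast+
qed

lemma harmonic_map_on_bounded_linear:
  assumes "open D" "bounded_linear l" "harmonic_map_on D f"
  shows "harmonic_map_on D (\<lambda>z. l (f z) + c)"
    and "\<And>z. z \<in> D \<Longrightarrow> partial_x (\<lambda>z. l (f z) + c) z = l (partial_x f z)"
    and "\<And>z. z \<in> D \<Longrightarrow> partial_y (\<lambda>z. l (f z) + c) z = l (partial_y f z)"
proof -
  interpret bounded_linear l by fact
  have C: "C1_on D f" "C1_on D (partial_x f)" "C1_on D (partial_y f)"
    using assms(3) by (auto simp: harmonic_map_on_def C2_on_def)
  have L: "partial_x (partial_x f) z + partial_y (partial_y f) z = 0" if "z \<in> D" for z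
    using assms(3) that by (auto simp: harmonic_map_on_def C2_on_def)
  note 1 = C1_on_bounded_linear[OF assms(2) C(1), where c=c]
  show "\<And>z. z \<in> D \<Longrightarrow> partial_x (\<lambda>z. l (f z) + c) z = l (partial_x f z)"
    "\<And>z. z \<in> D \<Longrightarrow> partial_y (\<lambda>z. l (f z) + c) z = l (partial_y f z)" using 1 by blast+
  note x = C1_on_bounded_linear[OF assms(2) C(2), where c=0, unfolded add_0_right]
  note y = C1_on_bounded_linear[OF assms(2) C(3), where c=0, unfolded add_0_right]
  have d: "((\<lambda>z. l (f z) + c) has_derivative
      (\<lambda>h. Re h *\<^sub>R l (partial_x f z) + Im h *\<^sub>R l (partial_y f z))) (at z)" if "z \<in> D" for z
    using C1_onD[OF 1(1) that] 1(2,3)[OF that] by simp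
  note 2 = C2_onI[OF assms(1) d x(1) y(1)]
  show "harmonic_map_on D (\<lambda>z. l (f z) + c)"
    unfolding harmonic_map_on_def
    using 2 x(2) y(3) L by (auto simp: add[symmetric] zero)
qed

lemma conformal_harmonic_on_mono:
  assumes "conformal_harmonic_on D f" "D' \<subseteq> D"
  shows "conformal_harmonic_on D' f"
proof -
  have "continuous_on D' g" if "continuous_on D g" for g :: "complex \<Rightarrow> 'a"
    using that assms(2) continuous_on_subset by blast
  then have *: "C1_on D' g" if "C1_on D g" for g :: "complex \<Rightarrow> 'a"
    using that assms(2) unfolding C1_on_def by auto
  then show ?thesis
    using assms unfolding conformal_harmonic_on_def harmonic_map_on_def conformal_map_on_def C2_on_def
    by auto
qed

lemma C1_on_reflect:
  assumes "C1_on D f" and D: "\<forall>z\<in>D. - z \<in> D"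
  shows "C1_on D (\<lambda>z. f (- z))"
    and "\<And>z. z \<in> D \<Longrightarrow> partial_x (\<lambda>z. f (- z)) z = - partial_x f (- z)"
    and "\<And>z. z \<in> D \<Longrightarrow> partial_y (\<lambda>z. f (- z)) z = - partial_y f (- z)"
proof -
  have d: "((\<lambda>z. f (- z)) has_derivative
      (\<lambda>h. Re h *\<^sub>R (- partial_x f (- z)) + Im h *\<^sub>R (- partial_y f (- z)))) (at z)" if "z \<in> D" for z
  proof -
    have "((\<lambda>z. f (- z)) has_derivative (\<lambda>h. Re (- h) *\<^sub>R partial_x f (- z) + Im (- h) *\<^sub>R partial_y f (- z))) (at z)"
      using has_derivative_compose[OF has_derivative_minus[OF has_derivative_ident] C1_onD[OF assms(1) D[rule_format, OF that]]] .
    then show ?thesis by (simp add: algebra_simps)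
  qed
  have c: "continuous_on D (\<lambda>z. - g (- z))" if "continuous_on D g" for g :: "complex \<Rightarrow> 'a"
    by (intro continuous_on_minus continuous_on_compose2[OF that]) (auto intro!: continuous_intros simp: D)
  have "continuous_on D (\<lambda>z. - partial_x f (- z))" "continuous_on D (\<lambda>z. - partial_y f (- z))"
    using assms(1) c by (auto simp: C1_on_def)
  with d show "C1_on D (\<lambda>z. f (- z))"
    "\<And>z. z \<in> D \<Longrightarrow> partial_x (\<lambda>z. f (- z)) z = - partial_x f (- z)"
    "\<And>z. z \<in> D \<Longrightarrow> partial_y (\<lambda>z. f (- z)) z = - partial_y f (- z)"
    using C1_onI[of D "\<lambda>z. f (- z)" "\<lambda>z. - partial_x f (- z)" "\<lambda>z. - partial_y f (- z)"] by blast+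
qed

lemma C1_on_uminus:
  assumes "C1_on D f"
  shows "C1_on D (\<lambda>z. - f z)"
    and "\<And>z. z \<in> D \<Longrightarrow> partial_x (\<lambda>z. - f z) z = - partial_x f z"
    and "\<And>z. z \<in> D \<Longrightarrow> partial_y (\<lambda>z. - f z) z = - partial_y f z"
  using C1_on_bounded_linear[OF bounded_linear_minus[OF bounded_linear_ident] assms, where c=0, unfolded add_0_right]
  by blast+

text \<open>Precomposition with the rotation by \<open>\<pi>\<close> reverses the derivative at the centre of the disc; it makes the
  minimal metric even in the vector.\<close>

lemma conformal_harmonic_on_reflect:
  assumes "open D" "conformal_harmonic_on D f" and D: "\<forall>z\<in>D. - z \<in> D"
  shows "conformal_harmonic_on D (\<lambda>z. f (- z))"
    and "\<And>z. z \<in> D \<Longrightarrow> partial_x (\<lambda>z. f (- z)) z = - partial_x f (- z)"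
proof -
  have C: "C1_on D f" "C1_on D (partial_x f)" "C1_on D (partial_y f)"
    using assms(2) by (auto simp: conformal_harmonic_on_def harmonic_map_on_def C2_on_def)
  have L: "partial_x (partial_x f) z + partial_y (partial_y f) z = 0" if "z \<in> D" for z
    using assms(2) that by (auto simp: conformal_harmonic_on_def harmonic_map_on_def C2_on_def)
  note 1 = C1_on_reflect[OF C(1) D]
  note x = C1_on_uminus[OF C1_on_reflect(1)[OF C(2) D]]
  note y = C1_on_uminus[OF C1_on_reflect(1)[OF C(3) D]]
  have d: "((\<lambda>z. f (- z)) has_derivative
      (\<lambda>h. Re h *\<^sub>R (- partial_x f (- z)) + Im h *\<^sub>R (- partial_y f (- z)))) (at z)" if "z \<in> D" for z
    using C1_onD[OF 1(1) that] unfolding 1(2)[OF that] 1(3)[OF that] .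
  note 2 = C2_onI[OF assms(1) d x(1) y(1)]
  have "harmonic_map_on D (\<lambda>z. f (- z))"
    unfolding harmonic_map_on_def
    using 2 x(2) y(3) C1_on_reflect(2)[OF C(2) D] C1_on_reflect(3)[OF C(3) D] L D
    by auto
  moreover have "conformal_map_on D (\<lambda>z. f (- z))"
    using assms(2) D 1 by (auto simp: conformal_harmonic_on_def conformal_map_on_def)
  ultimately show "conformal_harmonic_on D (\<lambda>z. f (- z))" by (simp add: conformal_harmonic_on_def)
  show "\<And>z. z \<in> D \<Longrightarrow> partial_x (\<lambda>z. f (- z)) z = - partial_x f (- z)" by (fact 1)
qed

lemma conformal_harmonic_on_linear_plane:
  fixes p v w :: "'a::real_inner"
  assumes "v \<bullet> w = 0" "norm v = norm w"
  defines "f \<equiv> \<lambda>z. p + (Re z *\<^sub>R v + Im z *\<^sub>R w)"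
  shows "conformal_harmonic_on UNIV f" "partial_x f z = v"
proof -
  have d: "(f has_derivative (\<lambda>h. Re h *\<^sub>R v + Im h *\<^sub>R w)) (at z)" for z
    unfolding f_def by (auto intro!: derivative_eq_intros)
  have c': "C1_on UNIV (\<lambda>z. v)" "partial_x (\<lambda>z. v) z = 0" "partial_y (\<lambda>z. v) z = 0" for v :: 'a and z
    using C1_onI[of UNIV "\<lambda>z. v" "\<lambda>z. 0" "\<lambda>z. 0"] by auto
  note 1 = C1_onI[of UNIV f "\<lambda>_. v" "\<lambda>_. w", OF d]
  note 2 = C2_onI[OF open_UNIV d c'(1) c'(1)]
  show "partial_x f z = v" using 1 by auto
  show "conformal_harmonic_on UNIV f"
    using 1 2 c' assms unfolding conformal_harmonic_on_def harmonic_map_on_def conformal_map_on_def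
    by auto
qed

section \<open>Harmonic functions as real parts of holomorphic functions\<close>

text \<open>The second difference over a square is symmetric in the two variables, while the mean value
  theorem applied first in \<open>s\<close> and then in \<open>t\<close> expresses it by one mixed derivative. Comparing the two
  orders yields the symmetry of second derivatives.\<close>

lemma second_difference_mean_value:
  fixes F Fa Fab :: "real \<Rightarrow> real \<Rightarrow> real"
  assumes h: "0 < h"
    and 1: "\<And>s t. s \<in> {0..h} \<Longrightarrow> t \<in> {0..h} \<Longrightarrow> ((\<lambda>s. F s t) has_real_derivative Fa s t) (at s)"
    and 2: "\<And>s t. s \<in> {0..h} \<Longrightarrow> t \<in> {0..h} \<Longrightarrow> ((\<lambda>t. Fa s t) has_real_derivative Fab s t) (at t)"
  obtains s t where "s \<in> {0..h}" "t \<in> {0..h}" "F h h - F h 0 - F 0 h + F 0 0 = h * (h * Fab s t)"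
proof -
  have "((\<lambda>s. F s h - F s 0) has_real_derivative Fa s h - Fa s 0) (at s)" if "s \<in> {0..h}" for s
    using that h by (intro DERIV_diff 1) auto
  then obtain s where s: "0 < s" "s < h" "F h h - F h 0 - (F 0 h - F 0 0) = (h - 0) * (Fa s h - Fa s 0)"
    using MVT2[OF h, of "\<lambda>s. F s h - F s 0" "\<lambda>s. Fa s h - Fa s 0"] by auto
  obtain t where t: "0 < t" "t < h" "Fa s h - Fa s 0 = (h - 0) * Fab s t"
    using MVT2[OF h, of "\<lambda>t. Fa s t" "\<lambda>t. Fab s t"] 2 s by auto
  show ?thesis
    by (rule that[of s t]) (use s t in \<open>auto simp: algebra_simps\<close>)
qed

lemma partials_commute:
  fixes u :: "complex \<Rightarrow> real"
  assumes D: "open D" and u: "C2_on D u" and z: "z \<in> D"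
  shows "partial_y (partial_x u) z = partial_x (partial_y u) z"
proof (rule ccontr)
  let ?A = "partial_y (partial_x u)" and ?B = "partial_x (partial_y u)"
  assume ne: "?A z \<noteq> ?B z"
  have C: "C1_on D u" "C1_on D (partial_x u)" "C1_on D (partial_y u)"
    using u by (auto simp: C2_on_def)
  define e where "e = \<bar>?A z - ?B z\<bar> / 2"
  have e: "e > 0" using ne by (simp add: e_def)
  have cont: "isCont ?A z" "isCont ?B z"
    using C D z by (auto simp: C1_on_def continuous_on_eq_continuous_at)
  obtain d1 where d1: "d1 > 0" "\<And>w. dist w z < d1 \<Longrightarrow> dist (?A w) (?A z) < e"
    using cont(1) e unfolding continuous_at_eps_delta by blast
  obtain d2 where d2: "d2 > 0" "\<And>w. dist w z < d2 \<Longrightarrow> dist (?B w) (?B z) < e"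
    using cont(2) e unfolding continuous_at_eps_delta by blast
  obtain d3 where d3: "d3 > 0" "ball z d3 \<subseteq> D" using D z openE by blast
  define d where "d = min d1 (min d2 d3)"
  have d: "d > 0" using d1 d2 d3 by (auto simp: d_def)
  define h where "h = d / 3"
  have h: "h > 0" using d by (simp add: h_def)
  have near: "dist (z + Complex s t) z < d" if "s \<in> {0..h}" "t \<in> {0..h}" for s t
  proof -
    have "norm (Complex s t) \<le> \<bar>s\<bar> + \<bar>t\<bar>" using cmod_le[of "Complex s t"] by simp
    then show ?thesis using that d by (auto simp: dist_norm h_def)
  qed
  have inD: "z + Complex s t \<in> D" if "s \<in> {0..h}" "t \<in> {0..h}" for s t
    using near[OF that] d3 by (auto simp: d_def dist_commute)
  have der_s: "((\<lambda>s. f (z + Complex s t)) has_real_derivative partial_x f (z + Complex s t)) (at s)"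
    if "C1_on D f" "z + Complex s t \<in> D" for f s t
  proof -
    have "((\<lambda>s. z + Complex s t) has_derivative (\<lambda>k. complex_of_real k)) (at s)"
      by (auto intro!: derivative_eq_intros simp: Complex_eq)
    from has_derivative_compose[OF this C1_onD[OF that]]
    show ?thesis by (simp add: has_field_derivative_def mult_commute_abs)
  qed
  have der_t: "((\<lambda>t. f (z + Complex s t)) has_real_derivative partial_y f (z + Complex s t)) (at t)"
    if "C1_on D f" "z + Complex s t \<in> D" for f s t
  proof -
    have "((\<lambda>t. z + Complex s t) has_derivative (\<lambda>k. \<i> * complex_of_real k)) (at t)"
      by (auto intro!: derivative_eq_intros simp: Complex_eq)
    from has_derivative_compose[OF this C1_onD[OF that]]
    show ?thesis by (simp add: has_field_derivative_def mult_commute_abs)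
  qed
  let ?F = "\<lambda>s t. u (z + Complex s t)"
  obtain s t where st: "s \<in> {0..h}" "t \<in> {0..h}"
    "?F h h - ?F h 0 - ?F 0 h + ?F 0 0 = h * (h * ?A (z + Complex s t))"
    by (rule second_difference_mean_value[OF h, of ?F "\<lambda>s t. partial_x u (z + Complex s t)"
          "\<lambda>s t. ?A (z + Complex s t)"]) (use der_s der_t C inD in auto)
  obtain s' t' where st': "s' \<in> {0..h}" "t' \<in> {0..h}"
    "?F h h - ?F 0 h - ?F h 0 + ?F 0 0 = h * (h * ?B (z + Complex t' s'))"
    by (rule second_difference_mean_value[OF h, of "\<lambda>s t. ?F t s" "\<lambda>s t. partial_y u (z + Complex t s)"
          "\<lambda>s t. ?B (z + Complex t s)"]) (use der_s der_t C inD in auto)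
  have "?A (z + Complex s t) = ?B (z + Complex t' s')"
    using st(3) st'(3) h by (auto simp: algebra_simps)
  moreover have "\<bar>?A (z + Complex s t) - ?A z\<bar> < e"
    using d1(2)[of "z + Complex s t"] near[OF st(1,2)] by (simp add: d_def dist_real_def)
  moreover have "\<bar>?B (z + Complex t' s') - ?B z\<bar> < e"
    using d2(2)[of "z + Complex t' s'"] near[OF st'(2,1)] by (simp add: d_def dist_real_def)
  ultimately show False using e_def e by (smt (verit) field_sum_of_halves)
qed

text \<open>The function \<open>u\<^sub>x - i u\<^sub>y\<close> satisfies the Cauchy-Riemann equations: one of them is the symmetry of the mixed
  partials, the other is Laplace's equation. On a disc it has a primitive, whose real part is \<open>u\<close> up to
  a constant.\<close>

lemma harmonic_imp_Re_holomorphic: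
  fixes u :: "complex \<Rightarrow> real"
  assumes u: "harmonic_map_on D u" and D: "open D" and sub: "ball a r \<subseteq> D"
  obtains g where "g holomorphic_on ball a r" "\<And>z. z \<in> ball a r \<Longrightarrow> Re (g z) = u z"
    "\<And>z. z \<in> ball a r \<Longrightarrow> deriv g z = Complex (partial_x u z) (- partial_y u z)"
proof (cases "r > 0")
  case False
  then have "ball a r = {}" by simp
  then show ?thesis by (intro that[of "\<lambda>_. 0"]) (simp_all only: holomorphic_on_empty empty_iff)
next
  case True
  have L: "partial_x (partial_x u) z + partial_y (partial_y u) z = 0" if "z \<in> D" for z
    using u that by (auto simp: harmonic_map_on_def)
  have C: "C1_on D u" "C1_on D (partial_x u)" "C1_on D (partial_y u)"
    using u by (auto simp: harmonic_map_on_def C2_on_def)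
  define F where "F z = Complex (partial_x u z) (- partial_y u z)" for z
  have F': "(F has_field_derivative Complex (partial_x (partial_x u) z) (- partial_x (partial_y u) z)) (at z)"
    if z: "z \<in> D" for z
  proof -
    have "(F has_derivative (\<lambda>h. of_real (Re h *\<^sub>R partial_x (partial_x u) z + Im h *\<^sub>R partial_y (partial_x u) z)
        + \<i> * of_real (- (Re h *\<^sub>R partial_x (partial_y u) z + Im h *\<^sub>R partial_y (partial_y u) z)))) (at z)"
      unfolding F_def Complex_eq
      by (intro derivative_intros C1_onD[OF C(2) z] C1_onD[OF C(3) z])
    moreover have "partial_y (partial_x u) z = partial_x (partial_y u) z"
      using partials_commute[OF D _ z] u by (simp add: harmonic_map_on_def)
    moreover have "partial_y (partial_y u) z = - partial_x (partial_x u) z" using L[OF z] by linarith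
    ultimately show ?thesis
      unfolding has_field_derivative_def
      by (elim has_derivative_eq_rhs) (auto simp: fun_eq_iff complex_eq_iff algebra_simps)
  qed
  have "F holomorphic_on ball a r"
    using F' sub by (auto simp: holomorphic_on_def field_differentiable_def intro!: exI intro: has_field_derivative_at_within)
  then obtain g0 where g0: "\<And>z. z \<in> ball a r \<Longrightarrow> (g0 has_field_derivative F z) (at z within ball a r)"
    using holomorphic_convex_primitive'[OF convex_ball open_ball] by blast
  then have g0': "(g0 has_field_derivative F z) (at z)" if "z \<in> ball a r" for z
    using that by (metis at_within_open open_ball)
  have dz: "((\<lambda>z. Re (g0 z) - u z) has_derivative (\<lambda>h. 0)) (at z within ball a r)" if z: "z \<in> ball a r" for z
  proof -
    have "((\<lambda>z. Re (g0 z) - u z) has_derivative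
      (\<lambda>h. Re (F z * h) - (Re h *\<^sub>R partial_x u z + Im h *\<^sub>R partial_y u z))) (at z)"
      using g0'[OF z] C1_onD[OF C(1)] z sub
      by (intro derivative_intros) (auto simp: has_field_derivative_def)
    then show ?thesis
      by (auto simp: F_def mult.commute intro: has_derivative_at_withinI)
  qed
  obtain c where c: "\<And>z. z \<in> ball a r \<Longrightarrow> Re (g0 z) - u z = c"
    using has_derivative_zero_constant[OF convex_ball dz] by blast
  show ?thesis
  proof (rule that[of "\<lambda>z. g0 z - of_real c"])
    have d: "((\<lambda>z. g0 z - of_real c) has_field_derivative F z) (at z)" if "z \<in> ball a r" for z
      using DERIV_diff[OF g0'[OF that] DERIV_const[of "of_real c"]] by simp
    then show "(\<lambda>z. g0 z - of_real c) holomorphic_on ball a r"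
      unfolding holomorphic_on_def field_differentiable_def by (meson has_field_derivative_at_within)
    show "deriv (\<lambda>z. g0 z - of_real c) z = Complex (partial_x u z) (- partial_y u z)" if "z \<in> ball a r" for z
      using DERIV_imp_deriv[OF d[OF that]] by (simp add: F_def)
    show "Re (g0 z - of_real c) = u z" if "z \<in> ball a r" for z using c[OF that] by simp
  qed
qed

text \<open>Write \<open>u = Re g\<close>. The Cayley transform that takes the right half plane to the disc and \<open>g 0\<close> to \<open>0\<close>
  turns \<open>g\<close> into a map to which the Schwarz lemma applies.\<close>

lemma positive_harmonic_gradient_bound:
  fixes u :: "complex \<Rightarrow> real"
  assumes u: "harmonic_map_on (ball 0 1) u" and pos: "\<And>z. z \<in> ball 0 1 \<Longrightarrow> u z > 0"
  shows "(partial_x u 0)\<^sup>2 + (partial_y u 0)\<^sup>2 \<le> (2 * u 0)\<^sup>2"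
proof -
  obtain g where g: "g holomorphic_on ball 0 1" "\<And>z. z \<in> ball 0 1 \<Longrightarrow> Re (g z) = u z"
    "deriv g 0 = Complex (partial_x u 0) (- partial_y u 0)"
    by (rule harmonic_imp_Re_holomorphic[OF u open_ball order_refl]) auto
  define m where "m = g 0"
  have m: "Re m > 0" using g(2)[of 0] pos[of 0] by (simp add: m_def)
  define f where "f z = (g z - m) / (g z + cnj m)" for z
  have nz: "g z + cnj m \<noteq> 0" if "z \<in> ball 0 1" for z
  proof
    assume "g z + cnj m = 0"
    then have "Re (g z + cnj m) = 0" by simp
    then show False using g(2)[OF that] pos[OF that] m by simp
  qed
  have hol: "f holomorphic_on ball 0 1"
    unfolding f_def using nz g(1) by (intro holomorphic_intros) auto
  have lt: "norm (f z) < 1" if "norm z < 1" for z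
  proof -
    have z: "z \<in> ball 0 1" using that by simp
    have "Re (g z) > 0" using g(2)[OF z] pos[OF z] by simp
    then have "Re (g z) * Re m > 0" using m by simp
    then have "(norm (g z - m))\<^sup>2 < (norm (g z + cnj m))\<^sup>2"
      unfolding cmod_power2 by (simp add: power2_eq_square algebra_simps)
    then have "norm (g z - m) < norm (g z + cnj m)" by (rule power_less_imp_less_base) simp
    then show ?thesis using nz[OF z] by (simp add: f_def norm_divide)
  qed
  have "norm (deriv f 0) \<le> 1"
    by (rule Schwarz_Lemma(2)[OF hol _ lt, of 0]) (auto simp: f_def m_def)
  moreover have "deriv f 0 = deriv g 0 / (2 * Re m)"
  proof (rule DERIV_imp_deriv)
    have "(g has_field_derivative deriv g 0) (at 0)"
      using g(1) holomorphic_derivI[OF g(1) open_ball, of 0] by simp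
    then have "(f has_field_derivative ((deriv g 0 - 0) * (g 0 + cnj m) - (g 0 - m) * (deriv g 0 + 0)) /
        ((g 0 + cnj m) * (g 0 + cnj m))) (at 0)"
      unfolding f_def using nz[of 0] by (intro derivative_intros) auto
    moreover have "g 0 + cnj m = of_real (2 * Re m)" by (simp add: m_def complex_eq_iff)
    ultimately show "(f has_field_derivative deriv g 0 / (2 * Re m)) (at 0)"
      using m by (simp add: m_def[symmetric])
  qed
  ultimately have "norm (deriv g 0) \<le> 2 * Re m" using m by (simp add: norm_divide norm_mult)
  then have "(norm (deriv g 0))\<^sup>2 \<le> (2 * Re m)\<^sup>2" by (rule power_mono) simp
  then show ?thesis using g(2)[of 0] by (simp add: g(3) cmod_power2 m_def)
qed

text \<open>The real part of Cauchy's integral formula at the centre of the circle.\<close>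

lemma mean_value_Re_holomorphic:
  assumes g: "g holomorphic_on ball c R" and r: "0 < r" "r < R"
  shows "((\<lambda>t. Re (g (c + of_real r * cis t))) has_integral 2 * pi * Re (g c)) {0..2*pi}"
proof -
  have "g holomorphic_on cball c r" using g r by (auto intro: holomorphic_on_subset)
  then have "((\<lambda>u. g u / (u - c)) has_contour_integral (2 * of_real pi * \<i> * g c)) (circlepath c r)"
    by (rule Cauchy_integral_circlepath_simple) (use r in simp)
  then have "((\<lambda>t. g (c + r * cis t) / (c + r * cis t - c) * r * \<i> * cis t) has_integral (2 * of_real pi * \<i> * g c)) {0..2*pi}"
    unfolding circlepath_def by (subst (asm) has_contour_integral_part_circlepath_iff) auto
  then have "((\<lambda>t. g (c + r * cis t) * \<i>) has_integral (2 * of_real pi * \<i> * g c)) {0..2*pi}"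
    by (rule has_integral_eq[rotated]) (use r in auto)
  from has_integral_linear[OF this bounded_linear_Im]
  show ?thesis by (simp add: o_def algebra_simps)
qed

section \<open>Lower integrals\<close>

text \<open>For an integrand of unknown measurability, such as the one of \<^const>\<open>minimal_length\<close>,
  \<^const>\<open>nn_integral\<close> is the lower integral. Upper bounds are therefore proved for measurable
  minorants, for which additivity and substitution are available.\<close>

lemma nn_integral_le_measurable_minorants:
  assumes "\<And>g. g \<in> borel_measurable M \<Longrightarrow> (\<And>x. g x \<le> f x) \<Longrightarrow> integral\<^sup>N M g \<le> c"
  shows "integral\<^sup>N M f \<le> c"
  unfolding nn_integral_def
proof (rule SUP_least)
  fix g assume "g \<in> {g. simple_function M g \<and> g \<le> f}"
  then have g: "simple_function M g" "g \<le> f" by auto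
  then have "integral\<^sup>S M g = integral\<^sup>N M g" by (simp add: nn_integral_eq_simple_integral)
  also have "\<dots> \<le> c" using g by (intro assms borel_measurable_simple_function) (auto simp: le_fun_def)
  finally show "integral\<^sup>S M g \<le> c" .
qed

section \<open>Piecewise continuously differentiable paths\<close>

definition C1_segment :: "(real \<Rightarrow> 'b::real_normed_vector) \<Rightarrow> real \<Rightarrow> real \<Rightarrow> bool"
  where "C1_segment \<gamma> a b \<longleftrightarrow> (\<exists>\<gamma>'. continuous_on {a..b} \<gamma>' \<and>
    (\<forall>t\<in>{a..b}. (\<gamma> has_vector_derivative \<gamma>' t) (at t within {a..b})))"

lemma piecewise_C1_pathI:
  assumes "\<And>a b. a \<in> S \<Longrightarrow> b \<in> S \<Longrightarrow> a < b \<Longrightarrow> S \<inter> {a<..<b} = {} \<Longrightarrow> C1_segment \<gamma> a b"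
    and "finite S" "{0, 1} \<subseteq> S" "S \<subseteq> {0..1}"
  shows "piecewise_C1_path \<gamma>"
  unfolding piecewise_C1_path_def using assms by (intro exI[of _ S]) (simp add: C1_segment_def)

lemma piecewise_C1_path_partitionE:
  assumes "piecewise_C1_path \<gamma>"
  obtains S where "finite S" "{0, 1} \<subseteq> S" "S \<subseteq> {0..1}"
    "\<And>a b. a \<in> S \<Longrightarrow> b \<in> S \<Longrightarrow> a < b \<Longrightarrow> S \<inter> {a<..<b} = {} \<Longrightarrow> C1_segment \<gamma> a b"
  using assms unfolding piecewise_C1_path_def C1_segment_def[symmetric] by metis

lemma C1_segment_affine:
  assumes \<gamma>: "C1_segment \<gamma> c d"
    and into: "\<And>t. t \<in> {a..b} \<Longrightarrow> m * t + k \<in> {c..d}"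
    and \<sigma>: "\<And>t. t \<in> {a..b} \<Longrightarrow> \<sigma> t = \<gamma> (m * t + k)"
  shows "C1_segment \<sigma> a b"
proof -
  obtain \<gamma>' where c: "continuous_on {c..d} \<gamma>'"
    and d: "\<And>t. t \<in> {c..d} \<Longrightarrow> (\<gamma> has_vector_derivative \<gamma>' t) (at t within {c..d})"
    using \<gamma> by (auto simp: C1_segment_def)
  let ?T = "\<lambda>t. m * t + k"
  have "continuous_on {a..b} (\<lambda>t. m *\<^sub>R \<gamma>' (?T t))"
    by (intro continuous_intros continuous_on_compose2[OF c]) (use into in auto)
  moreover have "(\<sigma> has_vector_derivative m *\<^sub>R \<gamma>' (?T t)) (at t within {a..b})" if t: "t \<in> {a..b}" for t
  proof -
    have "((\<gamma> \<circ> ?T) has_vector_derivative m *\<^sub>R \<gamma>' (?T t)) (at t within {a..b})"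
    proof (rule vector_diff_chain_within)
      show "(?T has_vector_derivative m) (at t within {a..b})"
        by (auto intro!: derivative_eq_intros simp: has_real_derivative_iff_has_vector_derivative[symmetric])
      show "(\<gamma> has_vector_derivative \<gamma>' (?T t)) (at (?T t) within ?T ` {a..b})"
        by (rule has_vector_derivative_within_subset[OF d[OF into[OF t]]]) (use into in auto)
    qed
    then show ?thesis
      by (rule has_vector_derivative_transform[OF t, rotated]) (simp add: \<sigma>)
  qed
  ultimately show ?thesis unfolding C1_segment_def by blast
qed

text \<open>Consecutive points of a partition are those with no other point in between; the cell containing \<open>t\<close>
  is found by rounding \<open>t\<close> down and up to the partition, the last cell taking care of \<open>t = 1\<close>.\<close>

lemma exists_partition_cell:
  fixes t :: real
  assumes S: "finite S" "{0, 1} \<subseteq> S" "S \<subseteq> {0..1}" and t: "t \<in> {0..1}"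
  obtains a b where "a \<in> S" "b \<in> S" "a < b" "S \<inter> {a<..<b} = {}" "t \<in> {a..b}"
proof (cases "t < 1")
  case True
  define L where "L = {s\<in>S. s \<le> t}"
  define U where "U = {s\<in>S. t < s}"
  have L: "finite L" "L \<noteq> {}" and U: "finite U" "U \<noteq> {}" using S t True by (auto simp: L_def U_def)
  have "Max L \<in> L" "Min U \<in> U" using L U by auto
  then have LU: "Max L \<in> S" "Min U \<in> S" "Max L \<le> t" "t < Min U" by (auto simp: L_def U_def)
  have "s \<notin> {Max L<..<Min U}" if "s \<in> S" for s
  proof (cases "s \<le> t")
    case True
    then have "s \<le> Max L" using that L by (intro Max_ge) (auto simp: L_def)
    then show ?thesis by simp
  next
    case False
    then have "Min U \<le> s" using that U by (intro Min_le) (auto simp: U_def)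
    then show ?thesis by simp
  qed
  then have "S \<inter> {Max L<..<Min U} = {}" by blast
  then show ?thesis using LU by (intro that[of "Max L" "Min U"]) auto
next
  case False
  then have t1: "t = 1" using t by auto
  define L where "L = {s\<in>S. s < 1}"
  have L: "finite L" "L \<noteq> {}" using S by (auto simp: L_def)
  then have "Max L \<in> L" by auto
  then have "Max L \<in> S" "Max L < 1" by (auto simp: L_def)
  moreover have "s \<notin> {Max L<..<1}" if "s \<in> S" for s
  proof (cases "s < 1")
    case True
    then have "s \<le> Max L" using that L by (intro Max_ge) (auto simp: L_def)
    then show ?thesis by simp
  qed simp
  ultimately show ?thesis
    using S(2) t1 by (intro that[of "Max L" 1]) auto
qed

lemma piecewise_C1_pathE:
  assumes "piecewise_C1_path \<gamma>"
  obtains S where "finite S" "continuous_on {0..1} \<gamma>"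
    "\<And>t. t \<in> {0<..<1} - S \<Longrightarrow> (\<gamma> has_vector_derivative vector_derivative \<gamma> (at t)) (at t)"
proof -
  obtain S where S: "finite S" "{0, 1} \<subseteq> S" "S \<subseteq> {0..1}"
    and C: "\<And>a b. a \<in> S \<Longrightarrow> b \<in> S \<Longrightarrow> a < b \<Longrightarrow> S \<inter> {a<..<b} = {} \<Longrightarrow> C1_segment \<gamma> a b"
    using piecewise_C1_path_partitionE[OF assms] by metis
  define I where "I = {(a, b) \<in> S \<times> S. a < b \<and> S \<inter> {a<..<b} = {}}"
  have "finite I" using S by (auto simp: I_def intro: finite_subset[of _ "S \<times> S"])
  moreover have "continuous_on {fst i..snd i} \<gamma>" if "i \<in> I" for i
  proof -
    have "C1_segment \<gamma> (fst i) (snd i)" using C[of "fst i" "snd i"] that by (auto simp: I_def)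
    then obtain \<gamma>' where "\<And>t. t \<in> {fst i..snd i} \<Longrightarrow> (\<gamma> has_vector_derivative \<gamma>' t) (at t within {fst i..snd i})"
      unfolding C1_segment_def by blast
    then show ?thesis by (rule continuous_on_vector_derivative)
  qed
  ultimately have "continuous_on (\<Union>i\<in>I. {fst i..snd i}) \<gamma>"
    by (intro continuous_on_closed_Union) auto
  moreover have "{0..1} \<subseteq> (\<Union>i\<in>I. {fst i..snd i})"
  proof
    fix t :: real assume "t \<in> {0..1}"
    from exists_partition_cell[OF S this] obtain a b where
      "a \<in> S" "b \<in> S" "a < b" "S \<inter> {a<..<b} = {}" "t \<in> {a..b}" .
    then show "t \<in> (\<Union>i\<in>I. {fst i..snd i})" by (auto simp: I_def intro!: bexI[of _ "(a, b)"])
  qed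
  ultimately have "continuous_on {0..1} \<gamma>" by (rule continuous_on_subset)
  moreover have "(\<gamma> has_vector_derivative vector_derivative \<gamma> (at t)) (at t)" if t: "t \<in> {0<..<1} - S" for t
  proof -
    have "t \<in> {0..1}" using t by auto
    from exists_partition_cell[OF S this] obtain a b where
      ab: "a \<in> S" "b \<in> S" "a < b" "S \<inter> {a<..<b} = {}" "t \<in> {a..b}" .
    have "t \<noteq> a" "t \<noteq> b" using t ab(1,2) by blast+
    then have t': "t \<in> {a<..<b}" using ab(5) by simp
    obtain \<gamma>' where "\<forall>t\<in>{a..b}. (\<gamma> has_vector_derivative \<gamma>' t) (at t within {a..b})"
      using C[OF ab(1-4)] unfolding C1_segment_def by metis
    then have "(\<gamma> has_vector_derivative \<gamma>' t) (at t within {a..b})" using ab(5) by (rule bspec)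
    then have "(\<gamma> has_vector_derivative \<gamma>' t) (at t within {a<..<b})"
      by (rule has_vector_derivative_within_subset) auto
    then have "(\<gamma> has_vector_derivative \<gamma>' t) (at t)"
      by (rule iffD1[OF has_vector_derivative_within_open[OF t' open_greaterThanLessThan]])
    from this vector_derivative_at[OF this] show ?thesis by simp
  qed
  ultimately show ?thesis using that S(1) by blast
qed

lemma piecewise_C1_path_reverse:
  assumes "piecewise_C1_path \<gamma>"
  shows "piecewise_C1_path (\<lambda>t. \<gamma> (1 - t))"
proof -
  obtain S where S: "finite S" "{0, 1} \<subseteq> S" "S \<subseteq> {0..1}"
    and C: "\<And>a b. a \<in> S \<Longrightarrow> b \<in> S \<Longrightarrow> a < b \<Longrightarrow> S \<inter> {a<..<b} = {} \<Longrightarrow> C1_segment \<gamma> a b"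
    using piecewise_C1_path_partitionE[OF assms] by metis
  let ?R = "\<lambda>t::real. 1 - t"
  have "C1_segment (\<lambda>t. \<gamma> (1 - t)) a b"
    if "a \<in> ?R ` S" "b \<in> ?R ` S" "a < b" "?R ` S \<inter> {a<..<b} = {}" for a b
  proof -
    have "s \<notin> {1 - b<..<1 - a}" if s: "s \<in> S" for s
    proof
      assume "s \<in> {1 - b<..<1 - a}"
      then have "1 - s \<in> ?R ` S \<inter> {a<..<b}" using s by auto
      then show False using \<open>?R ` S \<inter> {a<..<b} = {}\<close> by blast
    qed
    then have "C1_segment \<gamma> (1 - b) (1 - a)" using that by (intro C) auto
    then show ?thesis by (rule C1_segment_affine[where m = "-1" and k = 1]) auto
  qed
  moreover have "finite (?R ` S)" using S by simp
  moreover have "?R 1 \<in> ?R ` S" "?R 0 \<in> ?R ` S" using S(2) by blast+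
  then have "{0, 1} \<subseteq> ?R ` S" by simp
  moreover have "?R ` S \<subseteq> {0..1}" using S(3) by (auto simp: subset_iff)
  ultimately show ?thesis by (rule piecewise_C1_pathI)
qed

text \<open>The point \<open>1/2\<close> belongs to the new partition, so each cell lies in one of the two halves.\<close>

lemma piecewise_C1_path_join:
  assumes "piecewise_C1_path \<gamma>" "piecewise_C1_path \<delta>" and eq: "\<gamma> 1 = \<delta> 0"
  shows "piecewise_C1_path (\<gamma> +++ \<delta>)"
proof -
  obtain S where S: "finite S" "{0, 1} \<subseteq> S" "S \<subseteq> {0..1}"
    and C: "\<And>a b. a \<in> S \<Longrightarrow> b \<in> S \<Longrightarrow> a < b \<Longrightarrow> S \<inter> {a<..<b} = {} \<Longrightarrow> C1_segment \<gamma> a b"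
    using piecewise_C1_path_partitionE[OF assms(1)] by metis
  obtain T where T: "finite T" "{0, 1} \<subseteq> T" "T \<subseteq> {0..1}"
    and D: "\<And>a b. a \<in> T \<Longrightarrow> b \<in> T \<Longrightarrow> a < b \<Longrightarrow> T \<inter> {a<..<b} = {} \<Longrightarrow> C1_segment \<delta> a b"
    using piecewise_C1_path_partitionE[OF assms(2)] by metis
  define U where "U = (\<lambda>s. s / 2) ` S \<union> (\<lambda>s. (s + 1) / 2) ` T"
  have half: "1/2 \<in> U" using S by (auto simp: U_def)
  have US: "2 * u \<in> S" if "u \<in> U" "u \<le> 1/2" for u
  proof -
    from that(1) consider "2 * u \<in> S" | t where "t \<in> T" "u = (t + 1) / 2" by (auto simp: U_def)
    then show ?thesis
    proof cases
      case 2
      then have "t = 0" using T(3) that(2) by force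
      then have "2 * u = 1" using 2 by simp
      then show ?thesis using S(2) by simp
    qed
  qed
  have UT: "2 * u - 1 \<in> T" if "u \<in> U" "u \<ge> 1/2" for u
  proof -
    from that(1) consider s where "s \<in> S" "u = s / 2" | s where "s \<in> T" "u = (s + 1) / 2" by (auto simp: U_def)
    then show ?thesis
    proof cases
      case 1
      then have "s = 1" using S(3) that(2) by force
      then have "2 * u - 1 = 0" using 1 by simp
      then show ?thesis using T(2) by simp
    next
      case 2
      then have "2 * u - 1 = s" by simp
      then show ?thesis using 2 by metis
    qed
  qed
  have "C1_segment (\<gamma> +++ \<delta>) a b"
    if ab: "a \<in> U" "b \<in> U" "a < b" and cell: "U \<inter> {a<..<b} = {}" for a b
  proof (cases "b \<le> 1/2")
    case True
    have "s \<notin> {2 * a<..<2 * b}" if "s \<in> S" for s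
    proof
      assume "s \<in> {2 * a<..<2 * b}"
      then have "s / 2 \<in> U \<inter> {a<..<b}" using that by (auto simp: U_def)
      then show False using cell by blast
    qed
    then have "C1_segment \<gamma> (2 * a) (2 * b)" using ab US True by (intro C) auto
    then show ?thesis
      by (rule C1_segment_affine[where m = 2 and k = 0]) (use True in \<open>auto simp: joinpaths_def\<close>)
  next
    case False
    then have a: "a \<ge> 1/2" using half cell by force
    have "s \<notin> {2 * a - 1<..<2 * b - 1}" if "s \<in> T" for s
    proof
      assume "s \<in> {2 * a - 1<..<2 * b - 1}"
      then have "(s + 1) / 2 \<in> U \<inter> {a<..<b}" using that by (auto simp: U_def)
      then show False using cell by blast
    qed
    then have "C1_segment \<delta> (2 * a - 1) (2 * b - 1)" using ab UT a False by (intro D) auto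
    then show ?thesis
    proof (rule C1_segment_affine[where m = 2 and k = "-1"])
      fix t assume t: "t \<in> {a..b}"
      show "(\<gamma> +++ \<delta>) t = \<delta> (2 * t + - 1)"
      proof (cases "t = 1/2")
        case False
        then show ?thesis using t a by (auto simp: joinpaths_def)
      next
        case True
        then show ?thesis unfolding True by (simp add: joinpaths_def eq)
      qed
    qed auto
  qed
  moreover have "finite U" using S T by (simp add: U_def)
  moreover have "0 / 2 \<in> U" "(1 + 1) / 2 \<in> U"
    using S(2) T(2) unfolding U_def by blast+
  then have "{0, 1} \<subseteq> U" by simp
  moreover have "U \<subseteq> {0..1}" using S(3) T(3) by (auto simp: U_def)
  ultimately show ?thesis by (rule piecewise_C1_pathI)
qed

section \<open>The minimal metric\<close>

lemma minimal_metric_le: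
  assumes "r > 0" "f \<in> CH (ball 0 1) \<Omega>" "f 0 = p" "partial_x f 0 = r *\<^sub>R v"
  shows "minimal_metric \<Omega> p v \<le> ennreal (1 / r)"
  unfolding minimal_metric_def using assms by (intro Inf_lower) blast

text \<open>A positive factor only rescales \<open>r\<close>; for a negative one the competing disc is reflected.\<close>

lemma minimal_metric_scale:
  assumes m: "m \<noteq> 0"
  shows "minimal_metric \<Omega> p (m *\<^sub>R v) \<le> ennreal \<bar>m\<bar> * minimal_metric \<Omega> p v"
proof -
  let ?B = "minimal_metric \<Omega> p (m *\<^sub>R v)"
  have one: "ennreal \<bar>m\<bar> * ennreal (1 / \<bar>m\<bar>) = 1"
    using m by (simp flip: ennreal_mult)
  have "ennreal (1 / \<bar>m\<bar>) * ?B \<le> minimal_metric \<Omega> p v"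
    unfolding minimal_metric_def[of \<Omega> p v]
  proof (rule Inf_greatest)
    fix x assume "x \<in> {ennreal (1 / r) |r. r > 0 \<and>
      (\<exists>f\<in>CH (ball 0 1) \<Omega>. f 0 = p \<and> partial_x f 0 = r *\<^sub>R v)}"
    then obtain r f where x: "x = ennreal (1 / r)" and r: "0 < r"
      and f: "f \<in> CH (ball 0 1) \<Omega>" "f 0 = p" "partial_x f 0 = r *\<^sub>R v" by blast
    have "?B \<le> ennreal (1 / (r / \<bar>m\<bar>))"
    proof (cases "m > 0")
      case True
      then show ?thesis using r f by (intro minimal_metric_le[of _ f]) auto
    next
      case False
      have "conformal_harmonic_on (ball 0 1) f" using f by (simp add: CH_def)
      from conformal_harmonic_on_reflect[OF open_ball this]
      have "conformal_harmonic_on (ball 0 1) (\<lambda>z. f (- z))" "partial_x (\<lambda>z. f (- z)) 0 = - partial_x f 0"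
        by auto
      moreover have "(\<lambda>z. f (- z)) ` ball 0 1 \<subseteq> \<Omega>"
        using f(1) by (auto simp: CH_def image_subset_iff)
      ultimately show ?thesis
        using r f m False by (intro minimal_metric_le[of _ "\<lambda>z. f (- z)"]) (auto simp: CH_def divide_pos_neg)
    qed
    then have "ennreal (1 / \<bar>m\<bar>) * ?B \<le> ennreal (1 / \<bar>m\<bar>) * ennreal (1 / (r / \<bar>m\<bar>))"
      by (rule mult_left_mono) simp
    also have "\<dots> = ennreal (1 / r)" using m r by (simp flip: ennreal_mult)
    finally show "ennreal (1 / \<bar>m\<bar>) * ?B \<le> x" unfolding x .
  qed
  then have "ennreal \<bar>m\<bar> * (ennreal (1 / \<bar>m\<bar>) * ?B) \<le> ennreal \<bar>m\<bar> * minimal_metric \<Omega> p v"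
    by (rule mult_left_mono) simp
  then show ?thesis by (simp add: mult.assoc[symmetric] one)
qed

lemma minimal_metric_le_flat_disc:
  assumes r: "r > 0" and vw: "v \<bullet> w = 0" "norm v = norm w"
    and sub: "\<And>z. z \<in> ball 0 1 \<Longrightarrow> p + (Re z *\<^sub>R r *\<^sub>R v + Im z *\<^sub>R r *\<^sub>R w) \<in> \<Omega>"
  shows "minimal_metric \<Omega> p v \<le> ennreal (1 / r)"
proof -
  let ?f = "\<lambda>z. p + (Re z *\<^sub>R r *\<^sub>R v + Im z *\<^sub>R r *\<^sub>R w)"
  have vw': "(r *\<^sub>R v) \<bullet> (r *\<^sub>R w) = 0" "norm (r *\<^sub>R v) = norm (r *\<^sub>R w)" using vw by auto
  note 1 = conformal_harmonic_on_linear_plane[OF vw', of p]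
  have "?f \<in> CH (ball 0 1) \<Omega>"
    using conformal_harmonic_on_mono[OF 1(1)] sub by (auto simp: CH_def)
  then show ?thesis using 1(2) r by (intro minimal_metric_le[of _ ?f]) auto
qed

lemma ennreal_eq_0_if_le_inverse:
  assumes "\<And>r. r > 0 \<Longrightarrow> x \<le> ennreal (1 / r)"
  shows "x = 0"
proof -
  have "x \<le> 0 + ennreal e" if "e > 0" for e
    using assms[of "1 / e"] that by simp
  then have "x \<le> 0" by (rule ennreal_le_epsilon)
  then show ?thesis by simp
qed

text \<open>The competitor is the flat disc of radius \<open>R\<close> about \<open>p\<close> tangent to \<open>v\<close>; the second dimension
  completes \<open>v\<close> to a conformal pair.\<close>

lemma minimal_metric_le_norm:
  fixes p v :: "'a::euclidean_space"
  assumes dim: "DIM('a) \<ge> 2" and R: "R > 0" and sub: "ball p R \<subseteq> \<Omega>"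
  shows "minimal_metric \<Omega> p v \<le> ennreal (norm v / R)"
proof -
  obtain y where y: "y \<noteq> 0" "orthogonal v y" using orthogonal_to_vector_exists[OF dim] by blast
  define w where "w = (norm v / norm y) *\<^sub>R y"
  have vw: "v \<bullet> w = 0" "norm v = norm w" using y by (auto simp: w_def orthogonal_def)
  have le: "minimal_metric \<Omega> p v \<le> ennreal (1 / r)" if r: "r > 0" "r * norm v \<le> R" for r
  proof (rule minimal_metric_le_flat_disc[OF r(1) vw])
    fix z :: complex assume z: "z \<in> ball 0 1"
    let ?x = "Re z *\<^sub>R r *\<^sub>R v + Im z *\<^sub>R r *\<^sub>R w"
    have "(norm ?x)\<^sup>2 = ?x \<bullet> ?x" by (simp add: power2_norm_eq_inner)
    also have "\<dots> = ((Re z)\<^sup>2 + (Im z)\<^sup>2) * (r\<^sup>2 * (v \<bullet> v))"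
    proof -
      have "w \<bullet> w = v \<bullet> v" using vw(2) by (simp add: norm_eq)
      then show ?thesis
        using vw(1) by (simp add: inner_add_left inner_add_right inner_commute[of w v] power2_eq_square algebra_simps)
    qed
    also have "\<dots> = (norm z * (r * norm v))\<^sup>2"
      by (simp add: cmod_power2 power_mult_distrib power2_norm_eq_inner)
    finally have "norm ?x = norm z * (r * norm v)"
      using r by (simp add: power2_eq_iff_nonneg)
    also have "\<dots> \<le> norm z * R" using r by (intro mult_left_mono) auto
    also have "\<dots> < R" using z R by auto
    finally have "dist (p + ?x) p < R" by (simp add: dist_norm)
    then have "p + ?x \<in> ball p R" by (simp add: dist_commute)
    then show "p + ?x \<in> \<Omega>" using sub by blast
  qed
  show ?thesis
  proof (cases "v = 0")
    case True
    then have "minimal_metric \<Omega> p v = 0" using le R by (intro ennreal_eq_0_if_le_inverse) auto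
    then show ?thesis by simp
  next
    case False
    then show ?thesis using le[of "R / norm v"] R by simp
  qed
qed

section \<open>The minimal distance\<close>

text \<open>The infimum of lengths before its conversion to a real number. The conversion sends infinity to zero, so
  symmetry and the triangle inequality are proved here, where they hold without finiteness.\<close>

definition minimal_edist :: "'b::real_inner set \<Rightarrow> 'b \<Rightarrow> 'b \<Rightarrow> ennreal"
  where "minimal_edist \<Omega> p q = Inf {minimal_length \<Omega> \<gamma> | \<gamma>.
      piecewise_C1_path \<gamma> \<and> \<gamma> ` {0..1} \<subseteq> \<Omega> \<and> \<gamma> 0 = p \<and> \<gamma> 1 = q}"

lemma minimal_dist_eq: "minimal_dist \<Omega> p q = enn2real (minimal_edist \<Omega> p q)"
  by (simp add: minimal_dist_def minimal_edist_def)

lemma minimal_edist_le: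
  "piecewise_C1_path \<gamma> \<Longrightarrow> \<gamma> ` {0..1} \<subseteq> \<Omega> \<Longrightarrow> minimal_edist \<Omega> (\<gamma> 0) (\<gamma> 1) \<le> minimal_length \<Omega> \<gamma>"
  unfolding minimal_edist_def by (intro Inf_lower) blast

lemma AE_lborel_not_in_finite:
  assumes "finite (S :: real set)"
  shows "AE x in lborel. x \<notin> S"
  using assms by (intro AE_I[of _ _ S]) (auto simp: emeasure_lborel_countable countable_finite finite_imp_closed)

text \<open>Common core of symmetry and the triangle inequality: on \<open>(a, b)\<close> the path \<open>\<sigma>\<close> is an affine
  reparametrization of \<open>\<gamma>\<close>, possibly reversing it or covering only a part of it. The factor \<open>m\<close> that the
  chain rule produces cancels the one from the substitution, by homogeneity of the metric.\<close>

lemma nn_integral_reparametrized_le_length: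
  assumes g: "g \<in> borel_measurable lborel" and \<gamma>: "piecewise_C1_path \<gamma>" and m: "m \<noteq> 0"
    and into: "\<And>t. t \<in> {a<..<b} \<Longrightarrow> m * t + k \<in> {0<..<1}"
    and \<sigma>: "\<And>t. t \<in> {a<..<b} \<Longrightarrow> \<sigma> t = \<gamma> (m * t + k)"
    and le: "\<And>t. t \<in> {a<..<b} \<Longrightarrow> g t \<le> minimal_metric \<Omega> (\<sigma> t) (vector_derivative \<sigma> (at t))"
  shows "(\<integral>\<^sup>+t\<in>{a<..<b}. g t \<partial>lborel) \<le> minimal_length \<Omega> \<gamma>"
proof -
  from \<gamma> obtain S where S: "finite S"
    "\<And>t. t \<in> {0<..<1} - S \<Longrightarrow> (\<gamma> has_vector_derivative vector_derivative \<gamma> (at t)) (at t)"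
    by (rule piecewise_C1_pathE) blast
  let ?h = "\<lambda>t. g t * indicator {a<..<b} t"
  have h: "?h \<in> borel_measurable borel" using g by measurable
  let ?T = "\<lambda>s. - k / m + (1 / m) * s"
  have "(\<integral>\<^sup>+t\<in>{a<..<b}. g t \<partial>lborel) = ennreal \<bar>1 / m\<bar> * (\<integral>\<^sup>+s. ?h (?T s) \<partial>lborel)"
    using m by (intro nn_integral_real_affine h) auto
  also have "\<dots> = (\<integral>\<^sup>+s. ennreal \<bar>1 / m\<bar> * ?h (?T s) \<partial>lborel)"
    by (intro nn_integral_cmult[symmetric] measurable_compose[OF _ h]) measurable
  also have "\<dots> \<le> minimal_length \<Omega> \<gamma>"
    unfolding minimal_length_def
  proof (rule nn_integral_mono_AE)
    show "AE s in lborel. ennreal \<bar>1 / m\<bar> * ?h (?T s)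
      \<le> minimal_metric \<Omega> (\<gamma> s) (vector_derivative \<gamma> (at s)) * indicator {0..1} s"
      using AE_lborel_not_in_finite[OF S(1)]
    proof eventually_elim
      case (elim s)
      show ?case
      proof (cases "?T s \<in> {a<..<b}")
        case True
        have s: "m * ?T s + k = s" using m by (simp add: field_simps)
        have "s \<in> {0<..<1}" using into[OF True] unfolding s .
        have "(\<gamma> has_vector_derivative vector_derivative \<gamma> (at s)) (at s)"
          using S(2)[of s] elim \<open>s \<in> {0<..<1}\<close> by blast
        then have d: "(\<gamma> has_vector_derivative vector_derivative \<gamma> (at s)) (at (m * ?T s + k))"
          unfolding s .
        have "((\<gamma> \<circ> (\<lambda>t. m * t + k)) has_vector_derivative m *\<^sub>R vector_derivative \<gamma> (at s)) (at (?T s))"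
          by (rule vector_diff_chain_at[where f = "\<lambda>t. m * t + k", OF _ d])
            (auto intro!: derivative_eq_intros simp: has_real_derivative_iff_has_vector_derivative[symmetric])
        then have "(\<sigma> has_vector_derivative m *\<^sub>R vector_derivative \<gamma> (at s)) (at (?T s))"
          by (rule has_vector_derivative_transform_within_open[OF _ open_greaterThanLessThan True])
            (simp add: \<sigma>)
        then have "vector_derivative \<sigma> (at (?T s)) = m *\<^sub>R vector_derivative \<gamma> (at s)"
          by (rule vector_derivative_at)
        then have "g (?T s) \<le> minimal_metric \<Omega> (\<gamma> s) (m *\<^sub>R vector_derivative \<gamma> (at s))"
          using le[OF True] \<sigma>[OF True] unfolding s by simp
        also have "\<dots> \<le> ennreal \<bar>m\<bar> * minimal_metric \<Omega> (\<gamma> s) (vector_derivative \<gamma> (at s))"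
          by (rule minimal_metric_scale[OF m])
        finally have "ennreal \<bar>1 / m\<bar> * g (?T s) \<le> ennreal \<bar>1 / m\<bar> *
            (ennreal \<bar>m\<bar> * minimal_metric \<Omega> (\<gamma> s) (vector_derivative \<gamma> (at s)))"
          by (rule mult_left_mono) simp
        also have "\<dots> = minimal_metric \<Omega> (\<gamma> s) (vector_derivative \<gamma> (at s))"
        proof -
          have "ennreal \<bar>1 / m\<bar> * ennreal \<bar>m\<bar> = 1" using m by (simp flip: ennreal_mult)
          then show ?thesis by (simp add: mult.assoc[symmetric])
        qed
        finally show ?thesis using True \<open>s \<in> {0<..<1}\<close> by simp
      qed simp
    qed
  qed
  finally show ?thesis .
qed

lemma minimal_edist_commute_le:
  "minimal_edist \<Omega> q p \<le> minimal_edist \<Omega> p q"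
  unfolding minimal_edist_def[of \<Omega> p q]
proof (rule Inf_greatest, clarsimp)
  fix \<gamma> :: "real \<Rightarrow> 'a" assume \<gamma>: "piecewise_C1_path \<gamma>" "\<gamma> ` {0..1} \<subseteq> \<Omega>"
  let ?\<sigma> = "\<lambda>t. \<gamma> (1 - t)"
  have "minimal_edist \<Omega> (?\<sigma> 0) (?\<sigma> 1) \<le> minimal_length \<Omega> ?\<sigma>"
    using \<gamma> by (intro minimal_edist_le piecewise_C1_path_reverse) auto
  also have "\<dots> \<le> minimal_length \<Omega> \<gamma>"
    unfolding minimal_length_def[of \<Omega> ?\<sigma>]
  proof (rule nn_integral_le_measurable_minorants)
    fix g :: "real \<Rightarrow> ennreal" assume g: "g \<in> borel_measurable lborel"
      and le: "\<And>t. g t \<le> minimal_metric \<Omega> (?\<sigma> t) (vector_derivative ?\<sigma> (at t)) * indicator {0..1} t"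
    have le': "g t \<le> minimal_metric \<Omega> (?\<sigma> t) (vector_derivative ?\<sigma> (at t))" if "t \<in> {0..1}" for t
      using le[of t] that by simp
    have "(\<integral>\<^sup>+t. g t \<partial>lborel) = (\<integral>\<^sup>+t\<in>{0<..<1}. g t \<partial>lborel)"
    proof (rule nn_integral_cong_AE)
      have "AE t in (lborel :: real measure). t \<notin> {0, 1::real}" by (rule AE_lborel_not_in_finite) simp
      then show "AE t in lborel. g t = g t * indicator {0<..<1} t"
      proof eventually_elim
        case (elim t)
        then show ?case using le[of t] by (cases "t \<in> {0..1}") (auto simp: indicator_def)
      qed
    qed
    also have "\<dots> \<le> minimal_length \<Omega> \<gamma>"
      by (rule nn_integral_reparametrized_le_length[OF g \<gamma>(1), where m = "-1" and k = 1 and \<sigma> = ?\<sigma>])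
        (use le' in auto)
    finally show "(\<integral>\<^sup>+t. g t \<partial>lborel) \<le> minimal_length \<Omega> \<gamma>" .
  qed
  finally show "minimal_edist \<Omega> (\<gamma> 1) (\<gamma> 0) \<le> minimal_length \<Omega> \<gamma>" by simp
qed

lemma minimal_edist_commute: "minimal_edist \<Omega> p q = minimal_edist \<Omega> q p"
  by (intro antisym minimal_edist_commute_le)

lemma minimal_edist_le_join:
  assumes \<gamma>: "piecewise_C1_path \<gamma>" "\<gamma> ` {0..1} \<subseteq> \<Omega>" and \<delta>: "piecewise_C1_path \<delta>" "\<delta> ` {0..1} \<subseteq> \<Omega>"
    and eq: "\<gamma> 1 = \<delta> 0"
  shows "minimal_edist \<Omega> (\<gamma> 0) (\<delta> 1) \<le> minimal_length \<Omega> \<gamma> + minimal_length \<Omega> \<delta>"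
proof -
  let ?\<sigma> = "\<gamma> +++ \<delta>"
  have "?\<sigma> ` {0..1} \<subseteq> \<Omega>"
    using \<gamma>(2) \<delta>(2) by (auto simp: joinpaths_def image_subset_iff)
  then have "minimal_edist \<Omega> (?\<sigma> 0) (?\<sigma> 1) \<le> minimal_length \<Omega> ?\<sigma>"
    using \<gamma> \<delta> eq by (intro minimal_edist_le piecewise_C1_path_join) auto
  also have "\<dots> \<le> minimal_length \<Omega> \<gamma> + minimal_length \<Omega> \<delta>"
    unfolding minimal_length_def[of \<Omega> ?\<sigma>]
  proof (rule nn_integral_le_measurable_minorants)
    fix g :: "real \<Rightarrow> ennreal" assume g: "g \<in> borel_measurable lborel"
      and le: "\<And>t. g t \<le> minimal_metric \<Omega> (?\<sigma> t) (vector_derivative ?\<sigma> (at t)) * indicator {0..1} t"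
    have le': "g t \<le> minimal_metric \<Omega> (?\<sigma> t) (vector_derivative ?\<sigma> (at t))" if "t \<in> {0..1}" for t
      using le[of t] that by simp
    have "(\<integral>\<^sup>+t. g t \<partial>lborel) =
        (\<integral>\<^sup>+t. g t * indicator {0<..<1/2} t + g t * indicator {1/2<..<1} t \<partial>lborel)"
    proof (rule nn_integral_cong_AE)
      have "AE t in (lborel :: real measure). t \<notin> {0, 1/2, 1::real}" by (rule AE_lborel_not_in_finite) simp
      then show "AE t in lborel. g t = g t * indicator {0<..<1/2} t + g t * indicator {1/2<..<1} t"
      proof eventually_elim
        case (elim t)
        show ?case
        proof (cases "t \<in> {0..1}")
          case True
          then show ?thesis using elim by (auto simp: indicator_def)
        next
          case False
          then show ?thesis using le[of t] by (auto simp: indicator_def)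
        qed
      qed
    qed
    also have "\<dots> = (\<integral>\<^sup>+t\<in>{0<..<1/2}. g t \<partial>lborel) + (\<integral>\<^sup>+t\<in>{1/2<..<1}. g t \<partial>lborel)"
      by (intro nn_integral_add borel_measurable_times_ennreal g borel_measurable_indicator) simp_all
    also have "\<dots> \<le> minimal_length \<Omega> \<gamma> + minimal_length \<Omega> \<delta>"
    proof (rule add_mono)
      show "(\<integral>\<^sup>+t\<in>{0<..<1/2}. g t \<partial>lborel) \<le> minimal_length \<Omega> \<gamma>"
        by (rule nn_integral_reparametrized_le_length[OF g \<gamma>(1), where m = 2 and k = 0 and \<sigma> = ?\<sigma>])
          (rule le' | simp add: joinpaths_def)+
      show "(\<integral>\<^sup>+t\<in>{1/2<..<1}. g t \<partial>lborel) \<le> minimal_length \<Omega> \<delta>"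
        by (rule nn_integral_reparametrized_le_length[OF g \<delta>(1), where m = 2 and k = "-1" and \<sigma> = ?\<sigma>])
          (rule le' | simp add: joinpaths_def)+
    qed
    finally show "(\<integral>\<^sup>+t. g t \<partial>lborel) \<le> minimal_length \<Omega> \<gamma> + minimal_length \<Omega> \<delta>" .
  qed
  finally show ?thesis by (simp add: joinpaths_def)
qed

lemma minimal_edist_triangle:
  "minimal_edist \<Omega> p s \<le> minimal_edist \<Omega> p q + minimal_edist \<Omega> q s"
proof (rule ennreal_le_epsilon)
  fix e :: real assume fin: "minimal_edist \<Omega> p q + minimal_edist \<Omega> q s < top" and e: "e > 0"
  have less: "x < x + ennreal (e / 2)" if "x < top" for x :: ennreal
    using e that by (cases x) (auto simp flip: ennreal_plus simp: ennreal_less_iff)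
  have "minimal_edist \<Omega> p q < minimal_edist \<Omega> p q + ennreal (e / 2)"
    using fin by (intro less) (auto simp: ennreal_add_less_top)
  then obtain \<gamma> where \<gamma>: "piecewise_C1_path \<gamma>" "\<gamma> ` {0..1} \<subseteq> \<Omega>" "\<gamma> 0 = p" "\<gamma> 1 = q"
    "minimal_length \<Omega> \<gamma> < minimal_edist \<Omega> p q + ennreal (e / 2)"
    unfolding minimal_edist_def[of \<Omega> p q] Inf_less_iff by blast
  have "minimal_edist \<Omega> q s < minimal_edist \<Omega> q s + ennreal (e / 2)"
    using fin by (intro less) (auto simp: ennreal_add_less_top)
  then obtain \<delta> where \<delta>: "piecewise_C1_path \<delta>" "\<delta> ` {0..1} \<subseteq> \<Omega>" "\<delta> 0 = q" "\<delta> 1 = s"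
    "minimal_length \<Omega> \<delta> < minimal_edist \<Omega> q s + ennreal (e / 2)"
    unfolding minimal_edist_def[of \<Omega> q s] Inf_less_iff by blast
  have "minimal_edist \<Omega> p s \<le> minimal_length \<Omega> \<gamma> + minimal_length \<Omega> \<delta>"
    using minimal_edist_le_join[OF \<gamma>(1,2) \<delta>(1,2)] \<gamma> \<delta> by simp
  also have "\<dots> \<le> (minimal_edist \<Omega> p q + ennreal (e / 2)) + (minimal_edist \<Omega> q s + ennreal (e / 2))"
    using \<gamma>(5) \<delta>(5) by (intro add_mono less_imp_le)
  also have "\<dots> = minimal_edist \<Omega> p q + minimal_edist \<Omega> q s + (ennreal (e / 2) + ennreal (e / 2))"
    by (simp add: ac_simps)
  also have "ennreal (e / 2) + ennreal (e / 2) = ennreal e" using e by (simp flip: ennreal_plus)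
  finally show "minimal_edist \<Omega> p s \<le> minimal_edist \<Omega> p q + minimal_edist \<Omega> q s + ennreal e" .
qed

lemma minimal_edist_segment_le:
  fixes p q :: "'a::real_inner"
  assumes K: "K \<ge> 0" and seg: "closed_segment p q \<subseteq> \<Omega>"
    and le: "\<And>x. x \<in> closed_segment p q \<Longrightarrow> minimal_metric \<Omega> x (q - p) \<le> ennreal K"
  shows "minimal_edist \<Omega> p q \<le> ennreal K"
proof -
  let ?\<gamma> = "\<lambda>t. p + t *\<^sub>R (q - p)"
  have d: "(?\<gamma> has_vector_derivative (q - p)) (at t within A)" for t A
    by (auto intro!: derivative_eq_intros simp: has_vector_derivative_def)
  have in_seg: "?\<gamma> t \<in> closed_segment p q" if "t \<in> {0..1}" for t
    using that by (auto simp: closed_segment_def algebra_simps intro!: exI[of _ t])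
  have "piecewise_C1_path ?\<gamma>"
    unfolding piecewise_C1_path_def
    by (rule exI[of _ "{0, 1}"]) (auto intro!: exI[of _ "\<lambda>_. q - p"] d)
  then have "minimal_edist \<Omega> (?\<gamma> 0) (?\<gamma> 1) \<le> minimal_length \<Omega> ?\<gamma>"
    using in_seg seg by (intro minimal_edist_le) auto
  also have "\<dots> \<le> (\<integral>\<^sup>+t. ennreal K * indicator {0..1::real} t \<partial>lborel)"
    unfolding minimal_length_def
    using le in_seg vector_derivative_at[OF d] by (intro nn_integral_mono) (auto simp: indicator_def)
  also have "\<dots> = ennreal K" by (simp add: nn_integral_cmult)
  finally show ?thesis by simp
qed

text \<open>The source of all lower bounds for the distance: a function whose differential is
  dominated by the metric is nonexpanding. The derivative of \<open>\<phi> \<circ> \<gamma>\<close> is Henstock-Kurzweil integrable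
  with the expected integral as soon as it exists off a finite set; this also provides its Lebesgue
  measurability, and it is absolutely integrable when the length is finite.\<close>

lemma abs_diff_le_minimal_length:
  fixes \<phi> :: "'a::real_inner \<Rightarrow> real"
  assumes \<phi>: "\<And>x. x \<in> \<Omega> \<Longrightarrow> (\<phi> has_derivative \<phi>' x) (at x)"
    and le: "\<And>x v. x \<in> \<Omega> \<Longrightarrow> ennreal \<bar>\<phi>' x v\<bar> \<le> minimal_metric \<Omega> x v"
    and \<gamma>: "piecewise_C1_path \<gamma>" "\<gamma> ` {0..1} \<subseteq> \<Omega>"
  shows "ennreal \<bar>\<phi> (\<gamma> 1) - \<phi> (\<gamma> 0)\<bar> \<le> minimal_length \<Omega> \<gamma>"
proof (cases "minimal_length \<Omega> \<gamma> = \<infinity>")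
  case False
  from \<gamma>(1) obtain S where S: "finite S" "continuous_on {0..1} \<gamma>"
    "\<And>t. t \<in> {0<..<1} - S \<Longrightarrow> (\<gamma> has_vector_derivative vector_derivative \<gamma> (at t)) (at t)"
    by (rule piecewise_C1_pathE) blast
  define h where "h t = \<phi>' (\<gamma> t) (vector_derivative \<gamma> (at t))" for t
  have "(h has_integral ((\<phi> \<circ> \<gamma>) 1 - (\<phi> \<circ> \<gamma>) 0)) {0..1}"
  proof (rule fundamental_theorem_of_calculus_interior_strong[OF S(1)])
    have "continuous_on \<Omega> \<phi>"
      using \<phi> by (meson continuous_at_imp_continuous_on has_derivative_continuous)
    then show "continuous_on {0..1} (\<phi> \<circ> \<gamma>)"
      using S(2) \<gamma>(2) by (intro continuous_on_compose) (auto intro: continuous_on_subset)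
    show "((\<phi> \<circ> \<gamma>) has_vector_derivative h t) (at t)" if t: "t \<in> {0<..<1} - S" for t
      unfolding h_def
      by (rule vector_derivative_diff_chain_within[OF S(3)[OF t]])
        (use \<phi> \<gamma>(2) t in \<open>auto simp: image_subset_iff intro: has_derivative_at_withinI\<close>)
  qed simp
  then have I: "(h has_integral (\<phi> (\<gamma> 1) - \<phi> (\<gamma> 0))) {0..1}" by simp
  let ?h = "\<lambda>t. indicator {0..1} t *\<^sub>R h t"
  have m: "?h \<in> borel_measurable lebesgue"
    by (rule has_integral_implies_lebesgue_measurable[OF I])
  have "(\<integral>\<^sup>+t. ennreal (norm (?h t)) \<partial>lebesgue) = (\<integral>\<^sup>+t. ennreal (norm (?h t)) \<partial>lborel)"
    by (rule nn_integral_completion)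
  also have "\<dots> \<le> minimal_length \<Omega> \<gamma>"
    unfolding minimal_length_def
    using le \<gamma>(2) by (intro nn_integral_mono) (auto simp: indicator_def h_def image_subset_iff)
  finally have bd: "(\<integral>\<^sup>+t. ennreal (norm (?h t)) \<partial>lebesgue) \<le> minimal_length \<Omega> \<gamma>" .
  then have int: "integrable lebesgue ?h"
    using False m by (intro integrableI_bounded) (auto simp: top.not_eq_extremum le_less_trans)
  have "(?h has_integral (\<phi> (\<gamma> 1) - \<phi> (\<gamma> 0))) UNIV"
    using I by (subst (asm) has_integral_restrict_UNIV[symmetric])
      (auto elim!: has_integral_eq[rotated] simp: indicator_def)
  then have "integral\<^sup>L lebesgue ?h = \<phi> (\<gamma> 1) - \<phi> (\<gamma> 0)"
    using has_integral_integral_lebesgue[OF int] has_integral_unique by blast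
  then show ?thesis
    using integral_norm_bound_ennreal[OF int] bd by (auto intro: order_trans)
qed simp

lemma abs_diff_le_minimal_edist:
  fixes \<phi> :: "'a::real_inner \<Rightarrow> real"
  assumes "\<And>x. x \<in> \<Omega> \<Longrightarrow> (\<phi> has_derivative \<phi>' x) (at x)"
    and "\<And>x v. x \<in> \<Omega> \<Longrightarrow> ennreal \<bar>\<phi>' x v\<bar> \<le> minimal_metric \<Omega> x v"
  shows "ennreal \<bar>\<phi> q - \<phi> p\<bar> \<le> minimal_edist \<Omega> p q"
  unfolding minimal_edist_def
  by (rule Inf_greatest) (use abs_diff_le_minimal_length[OF assms] in auto)

section \<open>Parabolicity of the complex plane\<close>

text \<open>If no point were a minimizer, the open sets on which \<open>f\<close> exceeds \<open>f w\<close> would cover \<open>K\<close>. Among the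
  finitely many points \<open>w\<close> that index a finite subcover, one with the smallest value is not covered.\<close>

lemma lower_semicontinuous_attains_minimum:
  fixes f :: "'a::topological_space \<Rightarrow> 'b::linorder"
  assumes "compact K" "K \<noteq> {}" and lsc: "\<And>c. openin (top_of_set K) {z \<in> K. c < f z}"
  obtains w where "w \<in> K" "\<And>z. z \<in> K \<Longrightarrow> f w \<le> f z"
proof (rule ccontr)
  assume no: "\<not> thesis"
  note min = that
  have ex: "\<exists>w\<in>K. f w < f z" if z: "z \<in> K" for z
  proof (rule ccontr)
    assume "\<not> (\<exists>w\<in>K. f w < f z)"
    then have "f z \<le> f w" if "w \<in> K" for w using that not_less by blast
    from min[OF z this] no show False by blast
  qed
  have "\<forall>c. \<exists>T. open T \<and> {z \<in> K. c < f z} = K \<inter> T" using lsc by (simp add: openin_open)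
  then obtain T where T: "\<And>c. open (T c)" "\<And>c. {z \<in> K. c < f z} = K \<inter> T c" by metis
  have "K \<subseteq> (\<Union>w\<in>K. T (f w))" using ex T(2) by blast
  then obtain C where C: "C \<subseteq> K" "finite C" "K \<subseteq> (\<Union>w\<in>C. T (f w))"
    using compactE_image[OF \<open>compact K\<close>, of K "\<lambda>w. T (f w)"] T(1) by metis
  then have "C \<noteq> {}" using \<open>K \<noteq> {}\<close> by blast
  then obtain w where w: "w \<in> C" "\<And>z. z \<in> C \<Longrightarrow> f w \<le> f z"
    using C(2) arg_min_if_finite[of C f] by (metis not_le)
  then obtain z where "z \<in> C" "w \<in> T (f z)" using C by blast
  then have "f z < f w" using T(2)[of "f z"] w(1) C(1) by blast
  then show False using w(2)[OF \<open>z \<in> C\<close>] by simp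
qed

lemma ennreal_integral_le_nn_integral:
  fixes k :: "real \<Rightarrow> real"
  assumes k: "(k has_integral I) {a..b}" and c: "continuous_on {a..b} k"
  shows "ennreal I \<le> (\<integral>\<^sup>+t\<in>{a..b}. ennreal (k t) \<partial>lborel)"
proof -
  have "continuous_on {a..b} (\<lambda>t. max 0 (k t))" using c by (intro continuous_intros)
  then obtain J where J: "((\<lambda>t. max 0 (k t)) has_integral J) {a..b}"
    using integrable_continuous_real integrable_integral by blast
  have "I \<le> J" using has_integral_le[OF k J] by simp
  then have "ennreal I \<le> ennreal J" by (rule ennreal_leI)
  also have "\<dots> = (\<integral>\<^sup>+t. ennreal (max 0 (k t)) * indicator {a..b} t \<partial>lborel)"
    by (rule nn_integral_has_integral_lebesgue'[OF _ J, symmetric]) simp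
  also have "\<dots> = (\<integral>\<^sup>+t\<in>{a..b}. ennreal (k t) \<partial>lborel)"
    by (intro nn_integral_cong) (simp add: max_def ennreal_neg)
  finally show ?thesis .
qed

text \<open>The added term \<open>\<epsilon> ln \<bar>z\<bar>\<close> is harmonic away from \<open>0\<close>, and \<open>- \<delta> \<bar>z\<bar>\<^sup>2\<close> makes the sum strictly superharmonic: over the
  circle of radius \<open>r\<close> its mean drops by \<open>\<delta> r\<^sup>2\<close>. At a minimum the mean cannot drop.\<close>

lemma superharmonic_log_no_interior_minimum:
  fixes q :: "complex \<Rightarrow> real"
  assumes q0: "\<And>z. 0 \<le> q z"
    and mean: "\<And>r. r > 0 \<Longrightarrow> (\<integral>\<^sup>+t\<in>{0..2*pi}. ennreal (q (w + of_real r * cis t)) \<partial>lborel) \<le> ennreal (2 * pi * q w)"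
    and \<delta>: "\<delta> > 0" and w: "w \<noteq> 0" and r: "0 < r" "r < norm w"
    and min: "\<And>z. dist z w = r \<Longrightarrow>
      q w + \<epsilon> * ln (norm w) - \<delta> * (norm w)\<^sup>2 \<le> q z + \<epsilon> * ln (norm z) - \<delta> * (norm z)\<^sup>2"
  shows False
proof -
  define H where "H = q w + \<epsilon> * ln (norm w) - \<delta> * (norm w)\<^sup>2"
  \<comment> \<open>On the circle the real part of \<open>G\<close> is the lower bound for \<open>q\<close> given by minimality: there \<open>\<bar>z\<bar>\<^sup>2\<close> agrees with the real part
    of \<open>\<bar>w\<bar>\<^sup>2 + r\<^sup>2 + 2 cnj w (z - w)\<close>, so the mean is a value of a holomorphic function.\<close>
  define G where "G z = of_real H - of_real \<epsilon> * (Ln (z / w) + of_real (ln (norm w)))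
    + of_real \<delta> * (of_real ((norm w)\<^sup>2 + r\<^sup>2) + 2 * cnj w * (z - w))" for z
  have pos: "Re (z / w) > 0" if "z \<in> ball w (norm w)" for z
  proof -
    have "norm (1 - z / w) < 1"
      using that w by (simp add: dist_norm field_simps norm_divide flip: norm_mult)
    then have "\<bar>Re (1 - z / w)\<bar> < 1" using abs_Re_le_cmod[of "1 - z / w"] by linarith
    then show ?thesis by simp
  qed
  have "G holomorphic_on ball w (norm w)"
    unfolding G_def using pos w by (intro holomorphic_intros) (auto simp: complex_nonpos_Reals_iff, force)
  from mean_value_Re_holomorphic[OF this r]
  have I: "((\<lambda>t. Re (G (w + of_real r * cis t))) has_integral 2 * pi * Re (G w)) {0..2*pi}" .
  have Gw: "Re (G w) = q w + \<delta> * r\<^sup>2" using w by (simp add: G_def H_def algebra_simps)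
  have cont: "continuous_on {0..2*pi} (\<lambda>t. Re (G (w + of_real r * cis t)))"
  proof (rule continuous_on_Re, rule continuous_on_compose2[of "ball w (norm w)" G])
    show "continuous_on (ball w (norm w)) G"
      by (rule holomorphic_on_imp_continuous_on) fact
    show "continuous_on {0..2*pi} (\<lambda>t. w + of_real r * cis t)" by (intro continuous_intros)
    show "(\<lambda>t. w + of_real r * cis t) ` {0..2*pi} \<subseteq> ball w (norm w)"
      using r by (auto simp: dist_norm norm_mult)
  qed
  have le: "Re (G (w + of_real r * cis t)) \<le> q (w + of_real r * cis t)" for t
  proof -
    define z where "z = w + of_real r * cis t"
    have dz: "dist z w = r" using r by (simp add: z_def dist_norm norm_mult)
    then have "z \<in> ball w (norm w)" using r by (simp add: dist_commute)
    then have z0: "z \<noteq> 0" by (auto simp: dist_norm)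
    have "(norm (w + (z - w)))\<^sup>2 = (norm w)\<^sup>2 + (norm (z - w))\<^sup>2 + Re (2 * cnj w * (z - w))"
      unfolding cmod_power2 by (simp add: power2_eq_square algebra_simps)
    then have "(norm z)\<^sup>2 = (norm w)\<^sup>2 + r\<^sup>2 + Re (2 * cnj w * (z - w))" using dz by (simp add: dist_norm)
    moreover have "Re (Ln (z / w)) + ln (norm w) = ln (norm z)"
      using w z0 by (simp add: norm_divide ln_div)
    ultimately have "Re (G z) = H - \<epsilon> * ln (norm z) + \<delta> * (norm z)\<^sup>2"
      unfolding G_def by simp
    then show ?thesis using min[OF dz] by (simp add: H_def z_def)
  qed
  have "ennreal (2 * pi * (q w + \<delta> * r\<^sup>2)) \<le> (\<integral>\<^sup>+t\<in>{0..2*pi}. ennreal (Re (G (w + of_real r * cis t))) \<partial>lborel)"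
    using ennreal_integral_le_nn_integral[OF I cont] unfolding Gw .
  also have "\<dots> \<le> (\<integral>\<^sup>+t\<in>{0..2*pi}. ennreal (q (w + of_real r * cis t)) \<partial>lborel)"
    using le by (intro nn_integral_mono mult_right_mono ennreal_leI) auto
  also have "\<dots> \<le> ennreal (2 * pi * q w)" using mean r by blast
  finally have "2 * pi * (q w + \<delta> * r\<^sup>2) \<le> 2 * pi * q w"
    using q0[of w] by (simp add: ennreal_le_iff)
  then have "\<delta> * r\<^sup>2 \<le> 0" by simp
  moreover have "\<delta> * r\<^sup>2 > 0" using \<delta> r by simp
  ultimately show False by linarith
qed

text \<open>Minimum principle on the annulus \<open>1 \<le> \<bar>z\<bar> \<le> R\<close> for the sum of \<open>q\<close> and the barrier
  \<open>\<epsilon> ln \<bar>z\<bar>\<close>, where \<open>R\<close> is so large that the barrier alone reaches \<open>m\<close> on the outer circle. The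
  logarithm is what makes this a fact about the plane: it is harmonic and tends to infinity. Finally \<open>\<delta>\<close> and
  \<open>\<epsilon>\<close> tend to zero.\<close>

lemma superharmonic_ge_minimum_on_disc:
  fixes q :: "complex \<Rightarrow> real"
  assumes q0: "\<And>z. 0 \<le> q z" and lsc: "\<And>c. open {z. c < q z}"
    and mean: "\<And>w r. r > 0 \<Longrightarrow> (\<integral>\<^sup>+t\<in>{0..2*pi}. ennreal (q (w + of_real r * cis t)) \<partial>lborel) \<le> ennreal (2 * pi * q w)"
    and m: "\<And>z. norm z \<le> 1 \<Longrightarrow> m \<le> q z"
  shows "m \<le> q x"
proof (cases "norm x \<le> 1")
  case False
  then have x: "norm x > 1" by simp
  have eps: "m \<le> q x + \<epsilon> * ln (norm x)" if \<epsilon>: "\<epsilon> > 0" for \<epsilon>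
  proof -
    define R where "R = max (norm x) (exp (m / \<epsilon>))"
    have R: "norm x \<le> R" "1 < R" using x by (auto simp: R_def)
    have "m / \<epsilon> \<le> ln R" using R by (simp add: ln_ge_iff R_def)
    then have lnR: "m \<le> \<epsilon> * ln R" using \<epsilon> by (simp add: field_simps)
    have "m \<le> q x + \<epsilon> * ln (norm x) + \<delta>'" if \<delta>': "\<delta>' > 0" for \<delta>'
    proof -
      define \<delta> where "\<delta> = \<delta>' / R\<^sup>2"
      have \<delta>: "\<delta> > 0" "\<delta> * R\<^sup>2 = \<delta>'" using \<delta>' R by (auto simp: \<delta>_def)
      define A where "A = {z::complex. 1 \<le> norm z \<and> norm z \<le> R}"
      define h where "h z = q z + \<epsilon> * ln (norm z) - \<delta> * (norm z)\<^sup>2" for z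
      have "A = cball 0 R - ball 0 1" by (auto simp: A_def)
      then have "compact A" by (simp add: compact_diff)
      moreover have "x \<in> A" using x R by (simp add: A_def)
      then have "A \<noteq> {}" by blast
      moreover have "openin (top_of_set A) {z \<in> A. c < h z}" for c
      proof -
        define k where "k z = c - \<epsilon> * ln (norm z) + \<delta> * (norm z)\<^sup>2" for z :: complex
        have "openin (top_of_set A) (A \<inter> k -` {..<d})" for d
          unfolding k_def by (intro continuous_openin_preimage_gen continuous_intros)
            (auto simp: A_def)
        then have "openin (top_of_set A) ((A \<inter> k -` {..<d}) \<inter> (A \<inter> {z. d < q z}))" for d
          by (rule openin_Int[OF _ openin_open_Int[OF lsc]])
        then have "openin (top_of_set A) (\<Union>d. (A \<inter> k -` {..<d}) \<inter> (A \<inter> {z. d < q z}))"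
          by (intro openin_Union) auto
        also have "(\<Union>d. (A \<inter> k -` {..<d}) \<inter> (A \<inter> {z. d < q z})) = {z \<in> A. c < h z}"
        proof (intro set_eqI iffI)
          fix z assume "z \<in> {z \<in> A. c < h z}"
          then have z: "z \<in> A" "k z < q z" by (auto simp: k_def h_def)
          then obtain d where "k z < d" "d < q z" using dense by blast
          then show "z \<in> (\<Union>d. (A \<inter> k -` {..<d}) \<inter> (A \<inter> {z. d < q z}))" using z(1) by auto
        qed (auto simp: k_def h_def)
        finally show ?thesis .
      qed
      ultimately obtain w where w: "w \<in> A" "\<And>z. z \<in> A \<Longrightarrow> h w \<le> h z"
        using lower_semicontinuous_attains_minimum[of A h] by blast
      have "m - \<delta>' \<le> h w"
      proof -
        consider "norm w = 1" | "norm w = R" | "1 < norm w" "norm w < R"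
          using w(1) by (force simp: A_def)
        then show ?thesis
        proof cases
          case 1
          have "\<delta> * 1 \<le> \<delta> * R\<^sup>2" using R \<delta>(1) by (intro mult_left_mono) (auto simp: one_le_power)
          then show ?thesis using m[of w] 1 \<delta>(2) by (simp add: h_def)
        next
          case 2
          then show ?thesis using lnR q0[of w] \<delta>(2) by (simp add: h_def)
        next
          case 3
          define r where "r = min (norm w - 1) (R - norm w)"
          have r: "0 < r" "r < norm w" using 3 by (auto simp: r_def min_def)
          have False
          proof (rule superharmonic_log_no_interior_minimum[OF q0 mean \<delta>(1) _ r])
            show "w \<noteq> 0" using 3 by auto
            fix z assume "dist z w = r"
            then have "norm (z - w) \<le> norm w - 1" "norm (z - w) \<le> R - norm w"
              by (auto simp: dist_norm r_def)
            then have "z \<in> A"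
              using norm_triangle_ineq2[of w "w - z"] norm_triangle_ineq[of w "z - w"]
              by (auto simp: A_def norm_minus_commute)
            then show "q w + \<epsilon> * ln (norm w) - \<delta> * (norm w)\<^sup>2 \<le> q z + \<epsilon> * ln (norm z) - \<delta> * (norm z)\<^sup>2"
              using w(2) by (simp add: h_def)
          qed
          then show ?thesis ..
        qed
      qed
      also have "h w \<le> h x" using w(2) x R by (simp add: A_def)
      also have "h x \<le> q x + \<epsilon> * ln (norm x)" using \<delta>(1) by (simp add: h_def)
      finally show ?thesis by simp
    qed
    then show ?thesis by (rule field_le_epsilon)
  qed
  show ?thesis
  proof (rule field_le_epsilon)
    fix e :: real assume e: "e > 0"
    have l: "ln (norm x) > 0" using x by (rule ln_gt_zero)
    show "m \<le> q x + e" using eps[of "e / ln (norm x)"] e l by simp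
  qed
qed (rule m)

text \<open>The minimum over the unit disc is a global minimum, attained at some \<open>w\<close>. If \<open>q z\<close> exceeded it, then so
  would the values of \<open>q\<close> on an arc through \<open>z\<close> of the circle about \<open>w\<close>, by semicontinuity, and the mean over that
  circle would be larger than \<open>q w\<close>.\<close>

lemma nonneg_superharmonic_constant:
  fixes q :: "complex \<Rightarrow> real"
  assumes q0: "\<And>z. 0 \<le> q z" and lsc: "\<And>c. open {z. c < q z}"
    and mean: "\<And>w r. r > 0 \<Longrightarrow> (\<integral>\<^sup>+t\<in>{0..2*pi}. ennreal (q (w + of_real r * cis t)) \<partial>lborel) \<le> ennreal (2 * pi * q w)"
  shows "q constant_on UNIV"
proof -
  have "openin (top_of_set (cball 0 1)) {z \<in> cball 0 1. c < q z}" for c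
  proof -
    have "{z \<in> cball 0 1. c < q z} = cball 0 1 \<inter> {z. c < q z}" by auto
    then show ?thesis using lsc by (simp add: openin_open_Int)
  qed
  from lower_semicontinuous_attains_minimum[OF compact_cball _ this]
  obtain w where "\<And>z. z \<in> cball 0 1 \<Longrightarrow> q w \<le> q z" by (metis cball_eq_empty not_one_less_zero)
  then have w: "q w \<le> q z" if "norm z \<le> 1" for z using that by simp
  have ge: "q w \<le> q z" for z by (rule superharmonic_ge_minimum_on_disc[OF q0 lsc mean w])
  have "q z \<le> q w" for z
  proof (rule ccontr)
    assume "\<not> q z \<le> q w"
    then have lt: "q w < q z" by simp
    define c where "c = (q w + q z) / 2"
    have c: "q w < c" "c < q z" using lt by (auto simp: c_def)
    define r where "r = norm (z - w)"
    have r: "r > 0" using lt by (auto simp: r_def)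
    define \<theta> where "\<theta> = Arg2pi (z - w)"
    have \<theta>: "0 \<le> \<theta>" "\<theta> < 2 * pi" "z = w + of_real r * cis \<theta>"
      using Arg2pi[of "z - w"] by (auto simp: \<theta>_def r_def cis_conv_exp is_Arg_def algebra_simps)
    define T where "T = (\<lambda>t. w + of_real r * cis t) -` {z. c < q z}"
    have "open T" unfolding T_def by (intro open_vimage lsc continuous_intros)
    moreover have "\<theta> \<in> T" using \<theta>(3) c by (simp add: T_def)
    ultimately obtain \<eta> where \<eta>: "\<eta> > 0" "ball \<theta> \<eta> \<subseteq> T" by (rule openE)
    define \<beta> where "\<beta> = min (\<theta> + \<eta>) (2 * pi)"
    have \<beta>: "\<theta> < \<beta>" "\<beta> \<le> 2 * pi" using \<theta> \<eta> by (auto simp: \<beta>_def)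
    have inT: "t \<in> T" if "t \<in> {\<theta><..<\<beta>}" for t
      using that \<eta>(2) by (auto simp: \<beta>_def dist_real_def subset_iff)
    have "ennreal (2 * pi * q w + (c - q w) * (\<beta> - \<theta>))
      = ennreal (q w) * ennreal (2 * pi) + ennreal (c - q w) * ennreal (\<beta> - \<theta>)"
      using q0 c \<beta> by (simp flip: ennreal_mult ennreal_plus add: mult.commute)
    also have "\<dots> = (\<integral>\<^sup>+t. ennreal (q w) * indicator {0..2*pi} t + ennreal (c - q w) * indicator {\<theta><..<\<beta>} t \<partial>lborel)"
      using \<beta> by (simp add: nn_integral_add nn_integral_cmult)
    also have "\<dots> \<le> (\<integral>\<^sup>+t\<in>{0..2*pi}. ennreal (q (w + of_real r * cis t)) \<partial>lborel)"
    proof (rule nn_integral_mono)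
      fix t
      have "ennreal (q w) + ennreal (c - q w) \<le> ennreal (q (w + of_real r * cis t))" if "t \<in> {\<theta><..<\<beta>}"
        using inT[OF that] q0 c by (simp add: T_def flip: ennreal_plus)
      then show "ennreal (q w) * indicator {0..2*pi} t + ennreal (c - q w) * indicator {\<theta><..<\<beta>} t
        \<le> ennreal (q (w + of_real r * cis t)) * indicator {0..2*pi} t"
        using \<theta> \<beta> ge by (auto simp: indicator_def intro: ennreal_leI)
    qed
    also have "\<dots> \<le> ennreal (2 * pi * q w)" by (rule mean[OF r])
    finally have "2 * pi * q w + (c - q w) * (\<beta> - \<theta>) \<le> 2 * pi * q w"
      using q0[of w] by (simp add: ennreal_le_iff)
    then have "(c - q w) * (\<beta> - \<theta>) \<le> 0" by simp
    moreover have "(c - q w) * (\<beta> - \<theta>) > 0" using c \<beta> by simp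
    ultimately show False by linarith
  qed
  then have "q z = q w" for z using ge by (meson antisym)
  then show ?thesis by (auto simp: constant_on_def)
qed

text \<open>Truncating \<open>- u\<close> from above preserves superharmonicity and semicontinuity and gives real values,
  so that the previous lemma applies at each level; \<open>u\<close> itself may take the value \<open>-\<infinity>\<close>.\<close>

lemma negative_subharmonic_constant:
  assumes u: "subharmonic_on UNIV u" and neg: "\<And>z. u z < 0"
  shows "u constant_on UNIV"
proof -
  have mean: "(\<integral>\<^sup>+t\<in>{0..2*pi}. e2ennreal (- u (a + of_real r * cis t)) \<partial>lborel) \<le> ennreal (2 * pi * x)"
    if r: "r > 0" and x: "u a = ereal (- x)" for a r x
  proof -
    define J where "J = (\<integral>\<^sup>+t\<in>{0..2*pi}. e2ennreal (- u (a + of_real r * cis t)) \<partial>lborel)"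
    have z: "e2ennreal (u z) = 0" for z using neg[of z] by (simp add: e2ennreal_neg)
    have x0: "x > 0" using neg[of a] x by simp
    have "ereal (- x) \<le> circle_mean u a r" using u r unfolding x[symmetric] subharmonic_on_def by blast
    also have "\<dots> = ereal (1 / (2 * pi)) * (- enn2ereal J)"
      unfolding circle_mean_def J_def[symmetric] z by (simp add: zero_ennreal.rep_eq)
    finally have le: "ereal (- x) \<le> ereal (1 / (2 * pi)) * (- enn2ereal J)" .
    have "J \<le> ennreal (2 * pi * x)"
    proof (cases J)
      case (real j)
      then have "- x \<le> (1 / (2 * pi)) * (- j)" using le by (simp add: enn2ereal_ennreal)
      then show ?thesis using real by (simp add: field_simps ennreal_leI)
    next
      case top
      then show ?thesis using le by (simp add: top_ennreal.rep_eq)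
    qed
    then show ?thesis by (simp add: J_def)
  qed
  have trunc: "(\<lambda>z. min (- u z) (ereal B)) constant_on UNIV" if B: "B > 0" for B
  proof -
    define q where "q z = real_of_ereal (min (- u z) (ereal B))" for z
    have pos: "0 < - u z" for z using neg[of z] by (simp add: ereal_uminus_less_reorder)
    have q: "ereal (q z) = min (- u z) (ereal B)" for z
      using pos[of z] B unfolding q_def by (cases "u z") (auto simp: min_def)
    have q0: "0 \<le> q z" for z
      using pos[of z] B q[of z] by (metis ereal_less_eq(5) le_less min_less_iff_conj zero_ereal_def ereal_less(2))
    have "q constant_on UNIV"
    proof (rule nonneg_superharmonic_constant[OF q0])
      fix c
      have "c < q z \<longleftrightarrow> c < B \<and> u z < ereal (- c)" for z
      proof -
        have "c < q z \<longleftrightarrow> ereal c < min (- u z) (ereal B)" unfolding q[symmetric] by simp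
        then show ?thesis by (cases "u z") (auto simp: min_less_iff_conj)
      qed
      then have "{z. c < q z} = (if c < B then {z \<in> UNIV. u z < ereal (- c)} else {})" by auto
      also have "open \<dots>"
        using u unfolding subharmonic_on_def by (simp add: openin_open)
      finally show "open {z. c < q z}" .
    next
      fix w :: complex and r :: real assume r: "r > 0"
      have le: "ennreal (q z) \<le> e2ennreal (- u z)" "ennreal (q z) \<le> ennreal B" for z
      proof -
        have "e2ennreal (ereal (q z)) \<le> e2ennreal (- u z)" by (intro e2ennreal_mono) (simp add: q)
        then show "ennreal (q z) \<le> e2ennreal (- u z)" by (simp add: ennreal.abs_eq[symmetric] e2ennreal_ereal)
        have "ereal (q z) \<le> ereal B" by (simp add: q)
        then show "ennreal (q z) \<le> ennreal B" by (intro ennreal_leI) simp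
      qed
      let ?I = "\<integral>\<^sup>+t\<in>{0..2*pi}. ennreal (q (w + of_real r * cis t)) \<partial>lborel"
      have "?I \<le> (\<integral>\<^sup>+t\<in>{0..2*pi}. ennreal B \<partial>lborel)"
        by (intro nn_integral_mono mult_right_mono le) simp
      also have "\<dots> = ennreal (2 * pi * B)" using B by (simp add: nn_integral_cmult mult.commute flip: ennreal_mult)
      finally have 1: "?I \<le> ennreal (2 * pi * B)" .
      show "?I \<le> ennreal (2 * pi * q w)"
      proof (cases "- u w < ereal B")
        case True
        then have "u w = ereal (- q w)" using q[of w] pos[of w] by (cases "u w") (auto simp: min_def split: if_splits)
        have "?I \<le> (\<integral>\<^sup>+t\<in>{0..2*pi}. e2ennreal (- u (w + of_real r * cis t)) \<partial>lborel)"
          by (intro nn_integral_mono mult_right_mono le) simp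
        also have "\<dots> \<le> ennreal (2 * pi * q w)" by (rule mean[OF r]) fact
        finally show ?thesis .
      next
        case False
        then have "q w = B" using q[of w] by (simp add: min_def split: if_splits)
        then show ?thesis using 1 by simp
      qed
    qed
    then show ?thesis unfolding constant_on_def q[symmetric] by auto
  qed
  have "u z = u 0" for z
  proof -
    have le: "- u z \<le> - u w" for z w
    proof (rule ccontr)
      assume "\<not> - u z \<le> - u w"
      then have lt: "- u w < - u z" by simp
      then obtain B where B: "- u w < ereal B" "ereal B < - u z"
        using ereal_dense2 by blast
      have "0 < - u w" using neg[of w] by (simp add: ereal_uminus_less_reorder)
      then have "B > 0" using B(1) by (metis ereal_less(2) less_trans)
      then have "min (- u z) (ereal B) = min (- u w) (ereal B)"
        using trunc unfolding constant_on_def by (metis UNIV_I)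
      then show False using B by (simp add: min_def split: if_splits)
    qed
    show ?thesis using le[of z 0] le[of 0 z] by simp
  qed
  then show ?thesis by (auto simp: constant_on_def)
qed

section \<open>Parabolic surfaces\<close>

text \<open>The plane is transported along \<open>e\<close> to a surface with points in \<^typ>\<open>'s\<close>, with \<open>inv e\<close> as its only
  chart.\<close>

lemma parabolic_plane:
  fixes e :: "complex \<Rightarrow> 's"
  assumes e: "inj e"
  defines "X \<equiv> pullback_topology (range e) (inv e) euclidean"
  shows "parabolic_surface X {(range e, inv e)}" "topspace X = range e"
    "inv_into (range e) (inv e) = e"
proof -
  have top: "topspace X = range e" by (simp add: X_def topspace_pullback_topology)
  then show "topspace X = range e" .
  have inj: "inj_on (inv e) (range e)" by (rule inj_on_inv_into) simp
  have img: "inv e ` range e = UNIV" using e by (simp add: image_image)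
  show ie: "inv_into (range e) (inv e) = e"
  proof
    fix z
    have "inv_into (range e) (inv e) (inv e (e z)) = e z" by (rule inv_into_f_f[OF inj]) simp
    then show "inv_into (range e) (inv e) z = e z" using e by simp
  qed
  have hom: "homeomorphic_map X euclidean (inv e)"
  proof (rule bijective_open_imp_homeomorphic_map)
    show "continuous_map X euclidean (inv e)"
      using continuous_map_pullback[of euclidean euclidean id "range e" "inv e"]
      by (simp add: X_def)
    show "open_map X euclidean (inv e)"
    proof (clarsimp simp: open_map_def X_def openin_pullback_topology)
      fix U :: "complex set" assume "open U"
      have "inv e ` (inv e -` U \<inter> range e) = U" using e by (force simp: image_iff intro: rev_bexI[of "e _"])
      then show "open (inv e ` (inv e -` U \<inter> range e))" using \<open>open U\<close> by simp
    qed
  qed (use top img inj in auto)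
  then have hs: "X homeomorphic_space (euclidean :: complex topology)"
    using homeomorphic_map_imp_homeomorphic_space by blast
  have sub: "subtopology X (range e) = X" using top by (metis subtopology_topspace)
  have an: "(inv e \<circ> inv_into (range e) (inv e)) analytic_on {z}" for z
    unfolding ie using e by (simp add: analytic_on_ident comp_def)
  have "second_countable (euclidean :: complex topology)"
  proof -
    obtain B :: "complex set set" where B: "countable B" "\<And>C. C \<in> B \<Longrightarrow> open C"
      "\<And>S. open S \<Longrightarrow> \<exists>U. U \<subseteq> B \<and> S = \<Union>U"
      using univ_second_countable by blast
    have "\<exists>V\<in>B. x \<in> V \<and> V \<subseteq> S" if "open S" "x \<in> S" for S x
      using B(3)[OF that(1)] that(2) by blast
    then show ?thesis using B(1,2) unfolding second_countable_def by (intro exI[of _ B]) simp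
  qed
  then have "conformal_surface X {(range e, inv e)}"
    unfolding conformal_surface_def
    using homeomorphic_Hausdorff_space[OF hs] homeomorphic_space_second_countability[OF hs]
      hom an top img sub openin_topspace[of X]
    by (auto simp: Hausdorff_space_euclidean)
  moreover have "connected_space X"
    using homeomorphic_connected_space[OF hs] using connectedin_topspace[of "euclidean :: complex topology"] connected_UNIV[where ?'a = complex] by simp
  moreover have "u constant_on topspace X"
    if u: "subharmonic_surface {(range e, inv e)} u" and neg: "\<forall>x\<in>topspace X. u x < 0" for u
  proof -
    have "(u \<circ> e) constant_on UNIV"
      using u neg top by (intro negative_subharmonic_constant) (auto simp: subharmonic_surface_def img ie)
    then show ?thesis unfolding top constant_on_def by auto
  qed
  ultimately show "parabolic_surface X {(range e, inv e)}"
    unfolding parabolic_surface_def by blast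
qed

lemma no_parabolic_minimal_surface_imp_weakly_hyperbolic:
  fixes \<Omega> :: "'b::real_inner set"
  assumes e: "\<exists>e :: complex \<Rightarrow> 's. inj e" and no: "no_parabolic_minimal_surface TYPE('s) \<Omega>"
  shows "weakly_hyperbolic \<Omega>"
  unfolding weakly_hyperbolic_def
proof
  fix f :: "complex \<Rightarrow> 'b" assume f: "f \<in> CH UNIV \<Omega>"
  obtain e :: "complex \<Rightarrow> 's" where e: "inj e" using e by blast
  note P = parabolic_plane[OF e]
  have img: "inv e ` range e = UNIV" using e by (simp add: image_image)
  have "f \<circ> inv e \<circ> e = f" using e by (simp add: fun_eq_iff)
  then have "conformal_harmonic_surface {(range e, inv e)} (f \<circ> inv e)"
    using f P(3) by (simp add: conformal_harmonic_surface_def CH_def img)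
  moreover have "(f \<circ> inv e) ` range e \<subseteq> \<Omega>" using f by (auto simp: CH_def)
  ultimately have "(f \<circ> inv e) constant_on range e"
    using no P(1,2) unfolding no_parabolic_minimal_surface_def by metis
  then show "f constant_on UNIV" using e by (auto simp: constant_on_def)
qed

text \<open>The mean value property gives equality. As \<open>v\<close> is negative, the integral of its positive part in
  \<^const>\<open>circle_mean\<close> vanishes.\<close>

lemma negative_harmonic_imp_subharmonic:
  fixes v :: "complex \<Rightarrow> real"
  assumes D: "open D" and v: "harmonic_map_on D v" and neg: "\<And>z. z \<in> D \<Longrightarrow> v z < 0"
  shows "subharmonic_on D (\<lambda>z. ereal (v z))"
  unfolding subharmonic_on_def
proof (intro conjI ballI allI impI)
  have cont: "continuous_on D v"
    using v by (auto simp: harmonic_map_on_def C2_on_def intro: C1_on_imp_continuous_on)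
  then have "continuous_on D (\<lambda>z. ereal (v z))" by (intro continuous_intros)
  then have "openin (top_of_set D) (D \<inter> (\<lambda>z. ereal (v z)) -` {..<c})" for c
    by (rule continuous_openin_preimage_gen) simp
  then show "openin (top_of_set D) {z \<in> D. ereal (v z) < c}" for c
    by (simp add: vimage_def Collect_conj_eq)
  fix a :: complex and r :: real assume *: "0 < r \<and> cball a r \<subseteq> D"
  then obtain R where R: "r < R" "ball a R \<subseteq> D"
  proof -
    obtain e where e: "e > 0" "(\<Union>x\<in>cball a r. ball x e) \<subseteq> D"
      using compact_subset_open_imp_ball_epsilon_subset[OF compact_cball D] * by metis
    have "ball a (r + e) \<subseteq> (\<Union>x\<in>cball a r. ball x e)"
    proof
      fix x assume x: "x \<in> ball a (r + e)"
      show "x \<in> (\<Union>x\<in>cball a r. ball x e)"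
      proof (cases "dist a x \<le> r")
        case True
        then show ?thesis using e by (intro UN_I[of x]) auto
      next
        case False
        then have ax: "a \<noteq> x" using * by auto
        define y where "y = a + (r / dist a x) *\<^sub>R (x - a)"
        have ay: "dist a y = r" using ax * by (simp add: y_def dist_norm norm_minus_commute)
        have "y - x = (r / dist a x - 1) *\<^sub>R (x - a)" by (simp add: y_def algebra_simps)
        then have "dist y x = \<bar>r / dist a x - 1\<bar> * dist a x"
          by (simp add: dist_norm norm_minus_commute)
        moreover have "r / dist a x - 1 \<le> 0" using False ax by (simp add: field_simps)
        then have "\<bar>r / dist a x - 1\<bar> * dist a x = (1 - r / dist a x) * dist a x" by simp
        moreover have "(1 - r / dist a x) * dist a x = dist a x - r" using ax by (simp add: field_simps)
        ultimately have yx: "dist y x = dist a x - r" by simp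
        have "dist a y = r" using ay .
        then show ?thesis using x yx * by (intro UN_I[of y]) auto
      qed
    qed
    then show ?thesis using that[of "r + e"] e by auto
  qed
  obtain g where g: "g holomorphic_on ball a R" "\<And>z. z \<in> ball a R \<Longrightarrow> Re (g z) = v z"
    by (rule harmonic_imp_Re_holomorphic[OF v D R(2)]) auto
  have circ: "a + of_real r * cis t \<in> ball a R" for t
    using * R by (simp add: dist_norm norm_mult)
  have "((\<lambda>t. Re (g (a + of_real r * cis t))) has_integral 2 * pi * Re (g a)) {0..2*pi}"
    using * R by (intro mean_value_Re_holomorphic[OF g(1)]) auto
  then have "((\<lambda>t. v (a + of_real r * cis t)) has_integral 2 * pi * v a) {0..2*pi}"
    using g(2) circ * R by simp
  then have I: "((\<lambda>t. - v (a + of_real r * cis t)) has_integral - (2 * pi * v a)) {0..2*pi}"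
    by (rule has_integral_neg)
  have neg': "v (a + of_real r * cis t) < 0" for t using neg circ R by blast
  have "a \<in> cball a r" using * by simp
  then have va: "v a < 0" using neg * by blast
  have "(\<integral>\<^sup>+t. ennreal (- v (a + of_real r * cis t)) * indicator {0..2*pi} t \<partial>lborel) = ennreal (- (2 * pi * v a))"
    using neg' by (intro nn_integral_has_integral_lebesgue'[OF _ I]) (simp add: less_imp_le)
  moreover have "e2ennreal (ereal x) = ennreal x" for x by (simp add: ennreal.abs_eq[symmetric] e2ennreal_ereal)
  moreover have "ennreal (v (a + of_real r * cis t)) = 0" for t using neg'[of t] by (simp add: ennreal_neg)
  moreover have "enn2ereal (ennreal (- (2 * pi * v a))) = ereal (- (2 * pi * v a))"
    using va by (intro enn2ereal_ennreal) (simp add: mult_nonneg_nonpos)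
  ultimately have "circle_mean (\<lambda>z. ereal (v z)) a r = ereal (v a)"
    unfolding circle_mean_def by (simp add: zero_ennreal.rep_eq)
  then show "ereal (v a) \<le> circle_mean (\<lambda>z. ereal (v z)) a r" by simp
qed simp

lemma locally_constant_imp_constant_on:
  assumes X: "connected_space X"
    and loc: "\<And>x. x \<in> topspace X \<Longrightarrow> \<exists>V. openin X V \<and> x \<in> V \<and> (\<forall>y\<in>V. F y = F x)"
  shows "F constant_on topspace X"
proof (cases "topspace X = {}")
  case False
  then obtain x0 where x0: "x0 \<in> topspace X" by blast
  have op: "openin X {x \<in> topspace X. P (F x)}" for P
  proof (subst openin_subopen, clarify)
    fix x assume x: "x \<in> topspace X" "P (F x)"
    then obtain V where V: "openin X V" "x \<in> V" "\<forall>y\<in>V. F y = F x" using loc by blast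
    have "V \<subseteq> {x \<in> topspace X. P (F x)}"
      using openin_subset[OF V(1)] V(3) x(2) by auto
    then show "\<exists>T. openin X T \<and> x \<in> T \<and> T \<subseteq> {x \<in> topspace X. P (F x)}"
      using V(1,2) by blast
  qed
  let ?T = "{x \<in> topspace X. F x = F x0}"
  have "topspace X - ?T = {x \<in> topspace X. F x \<noteq> F x0}" by auto
  then have "closedin X ?T" using op[of "\<lambda>y. y \<noteq> F x0"] by (simp add: closedin_def)
  then have "?T = {} \<or> ?T = topspace X"
    using X op[of "\<lambda>y. y = F x0"] unfolding connected_space_clopen_in by blast
  then have "?T = topspace X" using x0 by auto
  then show ?thesis by (auto simp: constant_on_def)
qed (auto simp: constant_on_def)

lemma parabolic_bounded_functional_constant:
  fixes F :: "'s \<Rightarrow> 'b::real_inner"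
  assumes X: "parabolic_surface X A" and F: "conformal_harmonic_surface A F"
    and bd: "\<And>x. x \<in> topspace X \<Longrightarrow> a \<bullet> F x < b"
  shows "(\<lambda>x. a \<bullet> F x) constant_on topspace X"
proof -
  let ?u = "\<lambda>x. ereal (a \<bullet> F x + - b)"
  have cs: "conformal_surface X A" using X by (simp add: parabolic_surface_def)
  have "subharmonic_surface A ?u"
    unfolding subharmonic_surface_def
  proof clarify
    fix U \<phi> assume U: "(U, \<phi>) \<in> A"
    let ?f = "F \<circ> inv_into U \<phi>"
    have op: "open (\<phi> ` U)" and "openin X U" using cs U by (auto simp: conformal_surface_def)
    then have sub: "U \<subseteq> topspace X" using openin_subset by blast
    have "harmonic_map_on (\<phi> ` U) ?f"
      using F U by (auto simp: conformal_harmonic_surface_def conformal_harmonic_on_def)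
    then have "harmonic_map_on (\<phi> ` U) (\<lambda>z. a \<bullet> ?f z + - b)"
      by (intro harmonic_map_on_bounded_linear(1)[OF op bounded_linear_inner_right])
    moreover have "a \<bullet> ?f z + - b < 0" if "z \<in> \<phi> ` U" for z
      using bd[of "inv_into U \<phi> z"] inv_into_into[OF that] sub by auto
    ultimately have "subharmonic_on (\<phi> ` U) (\<lambda>z. ereal (a \<bullet> ?f z + - b))"
      by (rule negative_harmonic_imp_subharmonic[OF op])
    then show "subharmonic_on (\<phi> ` U) (?u \<circ> inv_into U \<phi>)" by (simp add: comp_def)
  qed
  moreover have "\<forall>x\<in>topspace X. ?u x < 0" using bd by simp
  ultimately have "?u constant_on topspace X" using X unfolding parabolic_surface_def by blast
  then obtain y where "\<And>x. x \<in> topspace X \<Longrightarrow> ereal (a \<bullet> F x + - b) = y" by (auto simp: constant_on_def)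
  then have "\<forall>x\<in>topspace X. a \<bullet> F x = real_of_ereal y + b" by force
  then show ?thesis unfolding constant_on_def by blast
qed

text \<open>In each chart the partial derivatives of \<open>F\<close> are a conformal pair annihilated by \<open>N\<close>, hence zero.
  So \<open>F\<close> is locally constant.\<close>

lemma parabolic_map_constant:
  fixes F :: "'s \<Rightarrow> 'b::real_inner"
  assumes X: "parabolic_surface X A" and F: "conformal_harmonic_surface A F"
    and N: "\<And>a. a \<in> N \<Longrightarrow> (\<lambda>x. a \<bullet> F x) constant_on topspace X"
    and pair: "\<And>v w. v \<bullet> w = 0 \<Longrightarrow> norm v = norm w \<Longrightarrow> \<forall>a\<in>N. a \<bullet> v = 0 \<and> a \<bullet> w = 0 \<Longrightarrow> v = 0"
  shows "F constant_on topspace X"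
proof (rule locally_constant_imp_constant_on)
  have cs: "conformal_surface X A" using X by (simp add: parabolic_surface_def)
  show "connected_space X" using X by (simp add: parabolic_surface_def)
  fix x assume "x \<in> topspace X"
  then have "x \<in> (\<Union>(U, \<phi>)\<in>A. U)" using cs by (simp add: conformal_surface_def)
  then obtain U \<phi> where U: "(U, \<phi>) \<in> A" "x \<in> U" by blast
  then have op: "open (\<phi> ` U)" and oU: "openin X U"
    and hom: "homeomorphic_map (subtopology X U) (top_of_set (\<phi> ` U)) \<phi>"
    using cs by (auto simp: conformal_surface_def)
  have sub: "U \<subseteq> topspace X" using oU openin_subset by blast
  have inj: "inj_on \<phi> U"
    using hom sub by (auto simp: homeomorphic_eq_everything_map topspace_subtopology Int_absorb1)
  define f where "f = F \<circ> inv_into U \<phi>"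
  have f: "conformal_harmonic_on (\<phi> ` U) f"
    using F U by (auto simp: conformal_harmonic_surface_def f_def)
  then have hf: "harmonic_map_on (\<phi> ` U) f" and C1: "C1_on (\<phi> ` U) f"
    by (auto simp: conformal_harmonic_on_def harmonic_map_on_def C2_on_def)
  have ker: "a \<bullet> partial_x f z = 0 \<and> a \<bullet> partial_y f z = 0" if a: "a \<in> N" and z: "z \<in> \<phi> ` U" for a z
  proof -
    obtain c where c: "\<And>x. x \<in> topspace X \<Longrightarrow> a \<bullet> F x = c" using N[OF a] by (auto simp: constant_on_def)
    have "a \<bullet> f z + 0 = c" if "z \<in> \<phi> ` U" for z
      using c inv_into_into[OF that] sub by (auto simp: f_def)
    then have "((\<lambda>z. a \<bullet> f z + 0) has_derivative (\<lambda>h. 0)) (at z)"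
      by (intro has_derivative_transform_within_open[OF has_derivative_const[of c] op z]) simp
    from partials_eq[OF this] show ?thesis
      using harmonic_map_on_bounded_linear(2,3)[OF op bounded_linear_inner_right[of a] hf z, of 0] by simp
  qed
  have zero: "partial_x f z = 0" "partial_y f z = 0" if z: "z \<in> \<phi> ` U" for z
  proof -
    have c: "partial_x f z \<bullet> partial_y f z = 0" "norm (partial_x f z) = norm (partial_y f z)"
      using f z by (auto simp: conformal_harmonic_on_def conformal_map_on_def)
    then show "partial_x f z = 0" using ker z by (intro pair[of _ "partial_y f z"]) auto
    then show "partial_y f z = 0" using c by simp
  qed
  obtain r where r: "r > 0" "ball (\<phi> x) r \<subseteq> \<phi> ` U" using op U(2) by (meson imageI openE)
  have "(f has_derivative (\<lambda>h. 0)) (at z within ball (\<phi> x) r)" if "z \<in> ball (\<phi> x) r" for z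
  proof -
    have z: "z \<in> \<phi> ` U" using r that by blast
    show ?thesis using C1_onD[OF C1 z] zero[OF z] by (auto intro: has_derivative_at_withinI)
  qed
  then obtain c where c: "\<And>z. z \<in> ball (\<phi> x) r \<Longrightarrow> f z = c"
    using has_derivative_zero_constant[OF convex_ball, of "\<phi> x" r f] by blast
  define V where "V = {y \<in> U. \<phi> y \<in> ball (\<phi> x) r}"
  have "continuous_map (subtopology X U) (top_of_set (\<phi> ` U)) \<phi>"
    using hom homeomorphic_imp_continuous_map by blast
  then have "openin (subtopology X U) {y \<in> topspace (subtopology X U). \<phi> y \<in> ball (\<phi> x) r}"
    using r by (intro openin_continuous_map_preimage) (auto intro!: open_subset)
  moreover have "{y \<in> topspace (subtopology X U). \<phi> y \<in> ball (\<phi> x) r} = V"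
    using sub by (auto simp: V_def)
  ultimately have "openin X V" using oU openin_trans_full by metis
  moreover have "F y = c" if "y \<in> V" for y
    using c[of "\<phi> y"] that inj by (auto simp: V_def f_def)
  moreover have "x \<in> V" using U r by (simp add: V_def)
  ultimately show "\<exists>V. openin X V \<and> x \<in> V \<and> (\<forall>y\<in>V. F y = F x)" by blast
qed

section \<open>Affine planes in convex domains\<close>

definition bounded_above_on :: "'a::real_inner set \<Rightarrow> 'a \<Rightarrow> real \<Rightarrow> bool"
  where "bounded_above_on \<Omega> a b \<longleftrightarrow> (\<forall>x\<in>\<Omega>. a \<bullet> x < b)"

text \<open>Separation is strict because \<open>\<Omega>\<close> is open: from any point of \<open>\<Omega>\<close> one can still move a little in the direction of
  \<open>a\<close>.\<close>

lemma open_convex_separate_point: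
  fixes \<Omega> :: "'a::euclidean_space set"
  assumes "open \<Omega>" "convex \<Omega>" "\<Omega> \<noteq> {}" "x \<notin> \<Omega>"
  obtains a where "\<And>y. y \<in> \<Omega> \<Longrightarrow> a \<bullet> y < a \<bullet> x"
proof -
  obtain a b where ab: "a \<noteq> 0" "\<forall>y\<in>\<Omega>. a \<bullet> y \<le> b" "b \<le> a \<bullet> x"
    using separating_hyperplane_sets[of \<Omega> "{x}"] assms by auto
  have "a \<bullet> y < a \<bullet> x" if y: "y \<in> \<Omega>" for y
  proof -
    obtain e where e: "e > 0" "ball y e \<subseteq> \<Omega>" using assms(1) y openE by blast
    define y' where "y' = y + (e / (2 * norm a)) *\<^sub>R a"
    have "dist y y' < e" using ab(1) e by (simp add: y'_def dist_norm)
    then have "a \<bullet> y' \<le> b" using e ab(2) by auto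
    moreover have "a \<bullet> y' > a \<bullet> y" using ab(1) e by (simp add: y'_def inner_add_right)
    ultimately show ?thesis using ab(3) by linarith
  qed
  then show ?thesis by (rule that)
qed

text \<open>Otherwise \<open>p + span {v, w}\<close> is an affine plane for any \<open>p \<in> \<Omega>\<close>. A functional separating a point of
  this plane from \<open>\<Omega>\<close> is bounded above on \<open>\<Omega>\<close>, hence constant on the plane, which contains \<open>p\<close>.\<close>

lemma conformal_pair_orthogonal_to_bounded_functionals:
  fixes \<Omega> :: "'a::euclidean_space set"
  assumes \<Omega>: "open \<Omega>" "convex \<Omega>" "\<Omega> \<noteq> {}"
    and no: "\<not> (\<exists>P. affine P \<and> aff_dim P = 2 \<and> P \<subseteq> \<Omega>)"
    and vw: "v \<bullet> w = 0" "norm v = norm w"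
    and N: "\<And>a b. bounded_above_on \<Omega> a b \<Longrightarrow> a \<bullet> v = 0 \<and> a \<bullet> w = 0"
  shows "v = 0"
proof (rule ccontr)
  assume v: "v \<noteq> 0"
  then have w: "w \<noteq> 0" using vw by auto
  obtain p where p: "p \<in> \<Omega>" using \<Omega> by blast
  define P where "P = (+) p ` span {v, w}"
  have "independent {v, w}"
    by (rule pairwise_orthogonal_independent)
      (use v w vw in \<open>auto simp: pairwise_def orthogonal_def inner_commute\<close>)
  moreover have "v \<noteq> w" using vw v by auto
  ultimately have "dim (span {v, w}) = 2" by (simp add: dim_eq_card_independent)
  then have "aff_dim P = 2" by (simp add: P_def aff_dim_translation_eq aff_dim_subspace)
  moreover have "affine P" unfolding P_def
    by (metis affine_translation subspace_imp_affine subspace_span)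
  moreover have "P \<subseteq> \<Omega>"
  proof
    fix x assume "x \<in> P"
    then obtain s where s: "s \<in> span {v, w}" "x = p + s" by (auto simp: P_def)
    show "x \<in> \<Omega>"
    proof (rule ccontr)
      assume "x \<notin> \<Omega>"
      then obtain a where a: "\<And>y. y \<in> \<Omega> \<Longrightarrow> a \<bullet> y < a \<bullet> x"
        using open_convex_separate_point[OF \<Omega>] by blast
      then have "a \<bullet> v = 0 \<and> a \<bullet> w = 0" by (intro N[of _ "a \<bullet> x"]) (simp add: bounded_above_on_def)
      then have "orthogonal a s"
        by (intro orthogonal_to_span[OF s(1)]) (auto simp: orthogonal_def)
      then have "a \<bullet> s = 0" by (simp add: orthogonal_def)
      then show False using a[OF p] s(2) by (simp add: inner_add_right)
    qed
  qed
  ultimately show False using no by blast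
qed

lemma plane_orthonormal_frame:
  fixes P :: "'a::euclidean_space set"
  assumes P: "affine P" "aff_dim P = 2"
  obtains p v w where "v \<bullet> w = 0" "norm v = 1" "norm w = 1" "\<And>s t. p + (s *\<^sub>R v + t *\<^sub>R w) \<in> P"
proof -
  have "P \<noteq> {}" using P(2) by auto
  then obtain p where p: "p \<in> P" by blast
  define S where "S = (\<lambda>x. - p + x) ` P"
  have S: "subspace S" unfolding S_def using affine_diffs_subspace[OF P(1) p] .
  have "aff_dim S = 2" unfolding S_def aff_dim_translation_eq by (rule P(2))
  then have "dim S = 2" using aff_dim_subspace[OF S] by simp
  then obtain B where B: "B \<subseteq> S" "pairwise orthogonal B" "\<And>x. x \<in> B \<Longrightarrow> norm x = 1" "card B = 2"
    using orthonormal_basis_subspace[OF S] by metis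
  then obtain v w where vw: "B = {v, w}" "v \<noteq> w" by (meson card_2_iff)
  have "p + (s *\<^sub>R v + t *\<^sub>R w) \<in> P" for s t
  proof -
    have "s *\<^sub>R v + t *\<^sub>R w \<in> S" using S B(1) vw by (intro subspace_add subspace_scale) auto
    then show ?thesis by (auto simp: S_def)
  qed
  moreover have "v \<bullet> w = 0" using B(2) vw by (auto simp: pairwise_def orthogonal_def)
  moreover have "norm v = 1" "norm w = 1" using B(3) vw(1) by auto
  ultimately show ?thesis using that by blast
qed

lemma plane_imp_not_weakly_hyperbolic:
  fixes \<Omega> :: "'a::euclidean_space set"
  assumes P: "affine P" "aff_dim P = 2" "P \<subseteq> \<Omega>"
  shows "\<not> weakly_hyperbolic \<Omega>"
proof -
  obtain p v w where f: "v \<bullet> w = 0" "norm v = 1" "norm w = 1" "\<And>s t. p + (s *\<^sub>R v + t *\<^sub>R w) \<in> P"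
    using plane_orthonormal_frame[OF P(1,2)] by metis
  let ?f = "\<lambda>z. p + (Re z *\<^sub>R v + Im z *\<^sub>R w)"
  have "?f \<in> CH UNIV \<Omega>"
    using conformal_harmonic_on_linear_plane(1)[of v w p] f P(3) by (auto simp: CH_def)
  moreover have "\<not> ?f constant_on UNIV"
  proof
    assume "?f constant_on UNIV"
    then have "?f 0 = ?f 1" unfolding constant_on_def by (metis UNIV_I)
    then show False using f by auto
  qed
  ultimately show ?thesis by (auto simp: weakly_hyperbolic_def)
qed

text \<open>Discs of arbitrary radius in the plane make the metric vanish along a segment, whose end points
  are then at distance zero.\<close>

lemma plane_imp_not_hyperbolic:
  fixes \<Omega> :: "'a::euclidean_space set"
  assumes P: "affine P" "aff_dim P = 2" "P \<subseteq> \<Omega>"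
  shows "\<not> hyperbolic \<Omega>"
proof
  assume "hyperbolic \<Omega>"
  then interpret Metric_space \<Omega> "minimal_dist \<Omega>" by (simp add: hyperbolic_def)
  obtain p v w where f: "v \<bullet> w = 0" "norm v = 1" "norm w = 1" "\<And>s t. p + (s *\<^sub>R v + t *\<^sub>R w) \<in> P"
    using plane_orthonormal_frame[OF P(1,2)] by metis
  have in_P: "p + s *\<^sub>R v \<in> \<Omega>" for s using f(4)[of s 0] P(3) by auto
  have "minimal_metric \<Omega> (p + s *\<^sub>R v) v = 0" for s
  proof (rule ennreal_eq_0_if_le_inverse)
    fix r :: real assume r: "r > 0"
    show "minimal_metric \<Omega> (p + s *\<^sub>R v) v \<le> ennreal (1 / r)"
    proof (rule minimal_metric_le_flat_disc[OF r f(1)])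
      fix z :: complex
      have "p + ((s + Re z * r) *\<^sub>R v + (Im z * r) *\<^sub>R w) \<in> \<Omega>" using f(4) P(3) by blast
      then show "p + s *\<^sub>R v + (Re z *\<^sub>R r *\<^sub>R v + Im z *\<^sub>R r *\<^sub>R w) \<in> \<Omega>"
        by (simp add: algebra_simps)
    qed (simp add: f)
  qed
  moreover have seg: "\<exists>s. x = p + s *\<^sub>R v" if "x \<in> closed_segment p (p + v)" for x
    using that by (auto simp: closed_segment_def algebra_simps)
  ultimately have "minimal_edist \<Omega> p (p + v) \<le> ennreal 0"
    using in_P by (intro minimal_edist_segment_le) (force dest: seg)+
  then have "minimal_dist \<Omega> p (p + v) = 0" by (simp add: minimal_dist_eq)
  then have "p = p + v" using in_P[of 0] in_P[of 1] by (subst (asm) zero) auto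
  then show False using f by auto
qed

section \<open>Lower bounds for the minimal metric and distance\<close>

text \<open>The gradient bound for the positive harmonic function \<open>b - a \<bullet> f\<close>. Without conformality it
  controls only the components of the derivative along \<open>a\<close>.\<close>

lemma halfspace_gradient_bound:
  fixes f :: "complex \<Rightarrow> 'a::real_inner"
  assumes f: "f \<in> CH (ball 0 1) \<Omega>" and ab: "bounded_above_on \<Omega> a b"
  shows "(a \<bullet> partial_x f 0)\<^sup>2 + (a \<bullet> partial_y f 0)\<^sup>2 \<le> (2 * (b - a \<bullet> f 0))\<^sup>2"
proof -
  have h: "harmonic_map_on (ball 0 1) f" using f by (simp add: CH_def conformal_harmonic_on_def)
  have l: "bounded_linear (\<lambda>x. (- a) \<bullet> x)" by (rule bounded_linear_inner_right)
  note u = harmonic_map_on_bounded_linear[OF open_ball l h, where c = b]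
  have "(- a) \<bullet> f z + b > 0" if "z \<in> ball 0 1" for z
  proof -
    have "f z \<in> \<Omega>" using f that by (auto simp: CH_def)
    then show ?thesis using ab by (simp add: bounded_above_on_def)
  qed
  from positive_harmonic_gradient_bound[OF u(1) this] show ?thesis
    using u(2,3)[of 0] by (simp add: algebra_simps)
qed

lemma minimal_metric_ge_halfspace:
  fixes \<Omega> :: "'a::real_inner set"
  assumes ab: "bounded_above_on \<Omega> a b" and x: "x \<in> \<Omega>"
  shows "ennreal \<bar>a \<bullet> v / (2 * (b - a \<bullet> x))\<bar> \<le> minimal_metric \<Omega> x v"
  unfolding minimal_metric_def
proof (rule Inf_greatest)
  fix m assume "m \<in> {ennreal (1 / r) |r. r > 0 \<and>
      (\<exists>f\<in>CH (ball 0 1) \<Omega>. f 0 = x \<and> partial_x f 0 = r *\<^sub>R v)}"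
  then obtain r f where m: "m = ennreal (1 / r)" and r: "0 < r"
    and f: "f \<in> CH (ball 0 1) \<Omega>" "f 0 = x" "partial_x f 0 = r *\<^sub>R v" by blast
  have d: "b - a \<bullet> x > 0" using ab x by (simp add: bounded_above_on_def)
  have "(r * (a \<bullet> v))\<^sup>2 + (a \<bullet> partial_y f 0)\<^sup>2 \<le> (2 * (b - a \<bullet> x))\<^sup>2"
    using halfspace_gradient_bound[OF f(1) ab] f(2,3) by simp
  then have "(r * (a \<bullet> v))\<^sup>2 \<le> (2 * (b - a \<bullet> x))\<^sup>2"
    using zero_le_power2[of "a \<bullet> partial_y f 0"] by linarith
  then have "\<bar>r * (a \<bullet> v)\<bar> \<le> \<bar>2 * (b - a \<bullet> x)\<bar>" by (simp only: abs_le_square_iff)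
  then have "r * \<bar>a \<bullet> v\<bar> \<le> 2 * (b - a \<bullet> x)" using d r by (simp add: abs_mult)
  then have "\<bar>a \<bullet> v\<bar> / (2 * (b - a \<bullet> x)) \<le> 1 / r"
    using r d by (simp add: field_simps)
  then have "\<bar>a \<bullet> v / (2 * (b - a \<bullet> x))\<bar> \<le> 1 / r" using d by (simp add: abs_divide)
  then show "ennreal \<bar>a \<bullet> v / (2 * (b - a \<bullet> x))\<bar> \<le> m" unfolding m by (rule ennreal_leI)
qed

text \<open>The sum is a continuous function on the compact set of orthonormal pairs. It is positive there: a pair orthogonal
  to the basis \<open>B\<close> of the span of the bounded functionals would be orthogonal to all of them. The
  general case follows by homogeneity.\<close>

lemma conformal_pair_coercive:
  fixes \<Omega> :: "'a::euclidean_space set"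
  assumes \<Omega>: "open \<Omega>" "convex \<Omega>" "\<Omega> \<noteq> {}"
    and no: "\<not> (\<exists>P. affine P \<and> aff_dim P = 2 \<and> P \<subseteq> \<Omega>)"
  obtains B \<mu> where "finite B" "\<mu> > 0" "\<And>a. a \<in> B \<Longrightarrow> \<exists>b. bounded_above_on \<Omega> a b"
    "\<And>v w. v \<bullet> w = 0 \<Longrightarrow> norm v = norm w \<Longrightarrow> \<mu> * (norm v)\<^sup>2 \<le> (\<Sum>a\<in>B. (a \<bullet> v)\<^sup>2 + (a \<bullet> w)\<^sup>2)"
proof -
  define N where "N = {a. \<exists>b. bounded_above_on \<Omega> a b}"
  obtain B where B: "B \<subseteq> N" "independent B" "N \<subseteq> span B" using basis_exists[of N] by metis
  have fin: "finite B" using B(2) independent_imp_finite by blast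
  define Q where "Q vw = (\<Sum>a\<in>B. (a \<bullet> fst vw)\<^sup>2 + (a \<bullet> snd vw)\<^sup>2)" for vw :: "'a \<times> 'a"
  define K where "K = (sphere 0 1 \<times> sphere 0 1) \<inter> {vw :: 'a \<times> 'a. fst vw \<bullet> snd vw = 0}"
  have "compact K"
    unfolding K_def by (intro compact_Int_closed compact_Times compact_sphere closed_Collect_eq continuous_intros)
  have cQ: "continuous_on K Q" unfolding Q_def by (intro continuous_intros)
  have pos: "Q vw > 0" if vw: "vw \<in> K" for vw
  proof -
    have "Q vw \<ge> 0" by (simp add: Q_def sum_nonneg)
    moreover have "Q vw \<noteq> 0"
    proof
      assume "Q vw = 0"
      then have "\<forall>a\<in>B. (a \<bullet> fst vw)\<^sup>2 + (a \<bullet> snd vw)\<^sup>2 = 0"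
        unfolding Q_def using fin by (subst (asm) sum_nonneg_eq_0_iff) auto
      then have "\<forall>a\<in>B. orthogonal (fst vw) a \<and> orthogonal (snd vw) a"
        by (auto simp: sum_power2_eq_zero_iff orthogonal_def inner_commute)
      then have "orthogonal (fst vw) a \<and> orthogonal (snd vw) a" if "a \<in> N" for a
        using B(3) that orthogonal_to_span[of a B] by blast
      then have "a \<bullet> fst vw = 0 \<and> a \<bullet> snd vw = 0" if "a \<in> N" for a
        using that by (simp add: orthogonal_def inner_commute)
      then have "fst vw = 0"
        using vw by (intro conformal_pair_orthogonal_to_bounded_functionals[OF \<Omega> no, of _ "snd vw"])
          (auto simp: K_def N_def)
      then show False using vw by (auto simp: K_def)
    qed
    ultimately show ?thesis by simp
  qed
  obtain \<mu> where \<mu>: "\<mu> > 0" "\<And>vw. vw \<in> K \<Longrightarrow> \<mu> \<le> Q vw"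
  proof (cases "K = {}")
    case False
    then obtain x where "x \<in> K" "\<And>y. y \<in> K \<Longrightarrow> Q x \<le> Q y"
      using continuous_attains_inf[OF \<open>compact K\<close> _ cQ] by blast
    then show ?thesis using pos that by blast
  next
    case True
    then show ?thesis using that[of 1] by simp
  qed
  show ?thesis
  proof (rule that[OF fin \<mu>(1)])
    show "\<exists>b. bounded_above_on \<Omega> a b" if "a \<in> B" for a using B(1) that by (auto simp: N_def)
    fix v w :: 'a assume vw: "v \<bullet> w = 0" "norm v = norm w"
    show "\<mu> * (norm v)\<^sup>2 \<le> (\<Sum>a\<in>B. (a \<bullet> v)\<^sup>2 + (a \<bullet> w)\<^sup>2)"
    proof (cases "v = 0")
      case True
      then show ?thesis by (simp add: sum_nonneg)
    next
      case False
      define n where "n = norm v"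
      have n: "n > 0" using False by (simp add: n_def)
      have "((1 / n) *\<^sub>R v, (1 / n) *\<^sub>R w) \<in> K" using vw n by (auto simp: K_def n_def)
      from \<mu>(2)[OF this] have "\<mu> * n\<^sup>2 \<le> Q ((1 / n) *\<^sub>R v, (1 / n) *\<^sub>R w) * n\<^sup>2"
        by (rule mult_right_mono) simp
      also have "\<dots> = (\<Sum>a\<in>B. (a \<bullet> v)\<^sup>2 + (a \<bullet> w)\<^sup>2)"
        unfolding Q_def sum_distrib_right using n by (intro sum.cong) (auto simp: field_simps power2_eq_square)
      finally show ?thesis by (simp add: n_def)
    qed
  qed
qed

text \<open>For a competing disc \<open>f\<close> the gradient bound controls the components of both partial derivatives along
  the finitely many functionals in \<open>B\<close>, hence by coercivity the whole vector \<open>r v\<close>. The bounds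
  \<open>b - a \<bullet> x\<close> grow at most linearly in \<open>x\<close>.\<close>

lemma minimal_metric_ge_linear_growth:
  fixes \<Omega> :: "'a::euclidean_space set"
  assumes \<Omega>: "open \<Omega>" "convex \<Omega>" "\<Omega> \<noteq> {}"
    and no: "\<not> (\<exists>P. affine P \<and> aff_dim P = 2 \<and> P \<subseteq> \<Omega>)"
  obtains c where "c > 0" "\<And>x v. x \<in> \<Omega> \<Longrightarrow> ennreal (c * norm v / (1 + norm (x - p))) \<le> minimal_metric \<Omega> x v"
proof -
  obtain B \<mu> where B: "finite B" "\<mu> > 0" "\<And>a. a \<in> B \<Longrightarrow> \<exists>b. bounded_above_on \<Omega> a b"
    and co: "\<And>v w. v \<bullet> w = 0 \<Longrightarrow> norm v = norm w \<Longrightarrow> \<mu> * (norm v)\<^sup>2 \<le> (\<Sum>a\<in>B. (a \<bullet> v)\<^sup>2 + (a \<bullet> w)\<^sup>2)"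
    by (rule conformal_pair_coercive[OF \<Omega> no]) (rule that)
  then obtain b where b: "\<And>a. a \<in> B \<Longrightarrow> bounded_above_on \<Omega> a (b a)" by metis
  define M where "M = (\<Sum>a\<in>B. (2 * (\<bar>b a - a \<bullet> p\<bar> + norm a))\<^sup>2) + 1"
  have M: "M > 0" unfolding M_def by (smt (verit) sum_nonneg zero_le_power2)
  define c where "c = sqrt (\<mu> / M)"
  have c: "c > 0" "c\<^sup>2 = \<mu> / M" using M B(2) by (auto simp: c_def)
  show ?thesis
  proof (rule that[OF c(1)])
    fix x v assume x: "x \<in> \<Omega>"
    define s where "s = 1 + norm (x - p)"
    have s: "s \<ge> 1" by (simp add: s_def)
    show "ennreal (c * norm v / (1 + norm (x - p))) \<le> minimal_metric \<Omega> x v"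
      unfolding minimal_metric_def
    proof (rule Inf_greatest)
      fix m assume "m \<in> {ennreal (1 / r) |r. r > 0 \<and>
          (\<exists>f\<in>CH (ball 0 1) \<Omega>. f 0 = x \<and> partial_x f 0 = r *\<^sub>R v)}"
      then obtain r f where m: "m = ennreal (1 / r)" and r: "0 < r"
        and f: "f \<in> CH (ball 0 1) \<Omega>" "f 0 = x" "partial_x f 0 = r *\<^sub>R v" by blast
      let ?w = "partial_y f 0"
      have conf: "(r *\<^sub>R v) \<bullet> ?w = 0" "norm (r *\<^sub>R v) = norm ?w"
        using f(1) unfolding f(3)[symmetric] by (auto simp: CH_def conformal_harmonic_on_def conformal_map_on_def)
      have "\<mu> * (r * norm v)\<^sup>2 \<le> (\<Sum>a\<in>B. (a \<bullet> (r *\<^sub>R v))\<^sup>2 + (a \<bullet> ?w)\<^sup>2)"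
        using co[OF conf] r by simp
      also have "\<dots> \<le> (\<Sum>a\<in>B. (2 * (\<bar>b a - a \<bullet> p\<bar> + norm a))\<^sup>2 * s\<^sup>2)"
      proof (rule sum_mono)
        fix a assume a: "a \<in> B"
        have pos: "b a - a \<bullet> x > 0" using b[OF a] x by (simp add: bounded_above_on_def)
        have "b a - a \<bullet> x = (b a - a \<bullet> p) - a \<bullet> (x - p)" by (simp add: inner_diff_right)
        also have "\<dots> \<le> \<bar>b a - a \<bullet> p\<bar> + norm a * norm (x - p)"
          using Cauchy_Schwarz_ineq2[of a "x - p"] by linarith
        also have "\<dots> \<le> (\<bar>b a - a \<bullet> p\<bar> + norm a) * s"
          by (simp add: s_def algebra_simps)
        finally have "2 * (b a - a \<bullet> x) \<le> 2 * (\<bar>b a - a \<bullet> p\<bar> + norm a) * s"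
          unfolding mult.assoc by (rule mult_left_mono) simp
        then have "(2 * (b a - a \<bullet> x))\<^sup>2 \<le> (2 * (\<bar>b a - a \<bullet> p\<bar> + norm a) * s)\<^sup>2"
          using pos by (intro power_mono) auto
        then show "(a \<bullet> (r *\<^sub>R v))\<^sup>2 + (a \<bullet> ?w)\<^sup>2 \<le> (2 * (\<bar>b a - a \<bullet> p\<bar> + norm a))\<^sup>2 * s\<^sup>2"
          using halfspace_gradient_bound[OF f(1) b[OF a]] f(2,3) by (simp add: power_mult_distrib)
      qed
      also have "\<dots> \<le> M * s\<^sup>2" by (simp add: M_def flip: sum_distrib_right) (simp add: algebra_simps)
      finally have "(\<mu> / M) * (r * norm v)\<^sup>2 \<le> s\<^sup>2" using M by (simp add: field_simps)
      then have "(c * (r * norm v))\<^sup>2 \<le> s\<^sup>2" by (simp only: power_mult_distrib c(2))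
      then have "c * (r * norm v) \<le> s" by (rule power2_le_imp_le) (use s in simp)
      then have "c * norm v / s \<le> 1 / r" using r s by (simp add: field_simps)
      then show "ennreal (c * norm v / (1 + norm (x - p))) \<le> m" unfolding m s_def by (rule ennreal_leI)
    qed
  qed
qed

lemma minimal_edist_ge_halfspace:
  fixes \<Omega> :: "'a::real_inner set"
  assumes ab: "bounded_above_on \<Omega> a b"
  shows "ennreal (\<bar>ln (b - a \<bullet> q) - ln (b - a \<bullet> p)\<bar> / 2) \<le> minimal_edist \<Omega> p q"
proof -
  let ?\<phi> = "\<lambda>x. ln (b - a \<bullet> x) / 2"
  have "ennreal \<bar>?\<phi> q - ?\<phi> p\<bar> \<le> minimal_edist \<Omega> p q"
  proof (rule abs_diff_le_minimal_edist)
    fix x assume x: "x \<in> \<Omega>"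
    then have pos: "b - a \<bullet> x > 0" using ab by (simp add: bounded_above_on_def)
    show "(?\<phi> has_derivative (\<lambda>v. - (a \<bullet> v) / (2 * (b - a \<bullet> x)))) (at x)"
      using pos by (auto intro!: derivative_eq_intros simp: field_simps)
    show "ennreal \<bar>- (a \<bullet> v) / (2 * (b - a \<bullet> x))\<bar> \<le> minimal_metric \<Omega> x v" for v
      using minimal_metric_ge_halfspace[OF ab x, of v] by simp
  qed
  then show ?thesis by (simp add: abs_divide flip: diff_divide_distrib)
qed

text \<open>The logarithm is a smooth substitute for a primitive of \<open>1 / (1 + s)\<close> with \<open>s = \<bar>x - p\<bar>\<close>: the differential of
  \<open>ln (1 + s\<^sup>2)\<close> is at most \<open>4 / (1 + s)\<close>.\<close>

lemma minimal_edist_ge_log: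
  fixes \<Omega> :: "'a::euclidean_space set"
  assumes \<Omega>: "open \<Omega>" "convex \<Omega>" "\<Omega> \<noteq> {}"
    and no: "\<not> (\<exists>P. affine P \<and> aff_dim P = 2 \<and> P \<subseteq> \<Omega>)"
  obtains c where "c > 0" "\<And>q. ennreal (c * ln (1 + (norm (q - p))\<^sup>2)) \<le> minimal_edist \<Omega> p q"
proof -
  obtain c where c: "c > 0"
    "\<And>x v. x \<in> \<Omega> \<Longrightarrow> ennreal (c * norm v / (1 + norm (x - p))) \<le> minimal_metric \<Omega> x v"
    using minimal_metric_ge_linear_growth[OF \<Omega> no] by metis
  let ?\<phi> = "\<lambda>x. c / 4 * ln (1 + (x - p) \<bullet> (x - p))"
  have *: "ennreal \<bar>?\<phi> q - ?\<phi> p\<bar> \<le> minimal_edist \<Omega> p q" for q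
  proof (rule abs_diff_le_minimal_edist)
    fix x assume x: "x \<in> \<Omega>"
    define s where "s = norm (x - p)"
    have s: "s \<ge> 0" "(x - p) \<bullet> (x - p) = s\<^sup>2" by (auto simp: s_def power2_norm_eq_inner)
    have pos: "1 + (x - p) \<bullet> (x - p) > 0" using inner_ge_zero[of "x - p"] by linarith
    show "(?\<phi> has_derivative (\<lambda>v. c / 2 * (((x - p) \<bullet> v) / (1 + (x - p) \<bullet> (x - p))))) (at x)"
      using pos by (auto intro!: derivative_eq_intros simp: field_simps inner_commute)
    fix v
    have "\<bar>(x - p) \<bullet> v\<bar> \<le> s * norm v" unfolding s_def by (rule Cauchy_Schwarz_ineq2)
    then have "\<bar>(x - p) \<bullet> v\<bar> / (1 + s\<^sup>2) \<le> s * norm v / (1 + s\<^sup>2)" by (rule divide_right_mono) simp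
    also have "\<dots> \<le> 2 * norm v / (1 + s)"
    proof -
      have "0 \<le> (s - 1)\<^sup>2 + (s\<^sup>2 + 1) + 1" by simp
      then have "s * (1 + s) \<le> 2 * (1 + s\<^sup>2)" by (simp add: power2_eq_square algebra_simps)
      then have "s * (1 + s) * norm v \<le> 2 * (1 + s\<^sup>2) * norm v" by (rule mult_right_mono) simp
      moreover have "1 + s\<^sup>2 > 0" by (simp add: add_pos_nonneg)
      ultimately show ?thesis using s(1) by (simp add: divide_simps algebra_simps)
    qed
    finally have "c / 2 * (\<bar>(x - p) \<bullet> v\<bar> / (1 + s\<^sup>2)) \<le> c / 2 * (2 * norm v / (1 + s))"
      using c(1) by (intro mult_left_mono) auto
    moreover have "\<bar>1 + s\<^sup>2\<bar> = 1 + s\<^sup>2" by simp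
    ultimately have "\<bar>c / 2 * (((x - p) \<bullet> v) / (1 + (x - p) \<bullet> (x - p)))\<bar> \<le> c * norm v / (1 + norm (x - p))"
      using c(1) unfolding s(2) by (simp add: abs_mult abs_divide s_def)
    then show "ennreal \<bar>c / 2 * (((x - p) \<bullet> v) / (1 + (x - p) \<bullet> (x - p)))\<bar> \<le> minimal_metric \<Omega> x v"
      using c(2)[OF x] ennreal_leI order_trans by blast
  qed
  show ?thesis
  proof (rule that[of "c / 4"])
    show "ennreal (c / 4 * ln (1 + (norm (q - p))\<^sup>2)) \<le> minimal_edist \<Omega> p q" for q
    proof -
      have "ln (1 + (q - p) \<bullet> (q - p)) \<ge> 0" by (simp add: ln_ge_zero)
      then have "\<bar>?\<phi> q - ?\<phi> p\<bar> = c / 4 * ln (1 + (norm (q - p))\<^sup>2)"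
        using c(1) by (simp add: power2_norm_eq_inner)
      then show ?thesis using *[of q] by simp
    qed
  qed (use c in simp)
qed

section \<open>Complete hyperbolicity and the equivalence\<close>

lemma minimal_edist_finite:
  fixes \<Omega> :: "'a::euclidean_space set"
  assumes dim: "DIM('a) \<ge> 2" and \<Omega>: "open \<Omega>" "convex \<Omega>" and pq: "p \<in> \<Omega>" "q \<in> \<Omega>"
  shows "minimal_edist \<Omega> p q < \<infinity>"
proof -
  have seg: "closed_segment p q \<subseteq> \<Omega>" using \<Omega>(2) pq by (rule closed_segment_subset[rotated 2])
  obtain e where e: "e > 0" "(\<Union>x\<in>closed_segment p q. ball x e) \<subseteq> \<Omega>"
    using compact_subset_open_imp_ball_epsilon_subset[OF compact_segment \<Omega>(1) seg] by metis
  have "minimal_edist \<Omega> p q \<le> ennreal (norm (q - p) / e)"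
    using e by (intro minimal_edist_segment_le[OF _ seg] minimal_metric_le_norm[OF dim]) auto
  then show ?thesis by (simp add: le_less_trans)
qed

text \<open>A Cauchy sequence is bounded for the distance, hence Euclidean bounded, and has a Euclidean limit point \<open>l\<close>. If
  \<open>l\<close> were a boundary point, the half space supporting at \<open>l\<close> would force the distances to infinity. Around
  an interior \<open>l\<close> the distance is at most a multiple of the Euclidean one, so a subsequence, and with it the
  sequence, converges to \<open>l\<close>.\<close>

lemma no_plane_imp_complete_hyperbolic:
  fixes \<Omega> :: "'a::euclidean_space set"
  assumes dim: "DIM('a) \<ge> 2" and \<Omega>: "open \<Omega>" "convex \<Omega>" "\<Omega> \<noteq> {}"
    and no: "\<not> (\<exists>P. affine P \<and> aff_dim P = 2 \<and> P \<subseteq> \<Omega>)"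
  shows "complete_hyperbolic \<Omega>"
proof -
  let ?d = "minimal_dist \<Omega>" and ?D = "minimal_edist \<Omega>"
  have D: "ennreal (?d p q) = ?D p q" if "p \<in> \<Omega>" "q \<in> \<Omega>" for p q
    using minimal_edist_finite[OF dim \<Omega>(1,2) that] by (simp add: minimal_dist_eq)
  have d_ge: "x \<le> ?d p q" if "p \<in> \<Omega>" "q \<in> \<Omega>" "ennreal x \<le> ?D p q" for p q x
    using that D[of p q] by (metis ennreal_le_iff enn2real_nonneg minimal_dist_eq)
  have d_le: "?d p q \<le> x" if "?D p q \<le> ennreal x" "0 \<le> x" for p q x
    unfolding minimal_dist_eq using that by (metis enn2real_leI)
  interpret Metric_space \<Omega> ?d
  proof
    show "0 \<le> ?d p q" for p q by (simp add: minimal_dist_eq)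
    show "?d p q = ?d q p" for p q by (simp add: minimal_dist_eq minimal_edist_commute)
    show "?d p q = 0 \<longleftrightarrow> p = q" if pq: "p \<in> \<Omega>" "q \<in> \<Omega>" for p q
    proof
      assume 0: "?d p q = 0"
      obtain c where c: "c > 0" "\<And>q. ennreal (c * ln (1 + (norm (q - p))\<^sup>2)) \<le> ?D p q"
        using minimal_edist_ge_log[OF \<Omega> no] by metis
      have "c * ln (1 + (norm (q - p))\<^sup>2) \<le> 0" using d_ge[OF pq c(2)] 0 by simp
      then have "ln (1 + (norm (q - p))\<^sup>2) \<le> 0" using c(1) by (simp add: mult_le_0_iff)
      then have "(norm (q - p))\<^sup>2 \<le> 0"
        using ln_gt_zero[of "1 + (norm (q - p))\<^sup>2"] by (smt (verit) zero_le_power2)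
      then show "p = q" by simp
    next
      assume "p = q"
      have "minimal_metric \<Omega> p 0 \<le> ennreal 0"
      proof -
        obtain e where "e > 0" "ball p e \<subseteq> \<Omega>" using \<Omega>(1) pq(1) openE by blast
        then show ?thesis using minimal_metric_le_norm[OF dim, of e p \<Omega> 0] by simp
      qed
      then have "?D p p \<le> ennreal 0" using pq by (intro minimal_edist_segment_le) auto
      then show "?d p q = 0" using \<open>p = q\<close> by (simp add: minimal_dist_eq)
    qed
    show "?d p s \<le> ?d p q + ?d q s" if "p \<in> \<Omega>" "q \<in> \<Omega>" "s \<in> \<Omega>" for p q s
    proof (rule d_le)
      have "?D p s \<le> ennreal (?d p q) + ennreal (?d q s)"
        using minimal_edist_triangle that D by metis
      then show "?D p s \<le> ennreal (?d p q + ?d q s)" by (simp add: minimal_dist_eq)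
    qed (simp add: minimal_dist_eq)
  qed
  have "mcomplete"
    unfolding mcomplete_def
  proof (intro allI impI)
    fix \<sigma> assume \<sigma>: "MCauchy \<sigma>"
    then have in\<Omega>: "\<sigma> n \<in> \<Omega>" for n by (auto simp: MCauchy_def)
    obtain K where K: "\<And>n. ?d (\<sigma> 0) (\<sigma> n) \<le> K"
    proof -
      obtain N where N: "\<And>n n'. N \<le> n \<Longrightarrow> N \<le> n' \<Longrightarrow> ?d (\<sigma> n) (\<sigma> n') < 1"
        using \<sigma> unfolding MCauchy_def by (meson zero_less_one)
      have "?d (\<sigma> 0) (\<sigma> n) \<le> (\<Sum>k\<le>N. ?d (\<sigma> 0) (\<sigma> k)) + 1" for n
      proof (cases "n \<le> N")
        case True
        then have "?d (\<sigma> 0) (\<sigma> n) \<le> (\<Sum>k\<le>N. ?d (\<sigma> 0) (\<sigma> k))" by (intro member_le_sum) auto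
        then show ?thesis by simp
      next
        case False
        have "?d (\<sigma> 0) (\<sigma> n) \<le> ?d (\<sigma> 0) (\<sigma> N) + ?d (\<sigma> N) (\<sigma> n)" using in\<Omega> by (intro triangle)
        moreover have "?d (\<sigma> 0) (\<sigma> N) \<le> (\<Sum>k\<le>N. ?d (\<sigma> 0) (\<sigma> k))" by (intro member_le_sum) auto
        ultimately show ?thesis using N[of N n] False by simp
      qed
      then show ?thesis by (rule that)
    qed
    obtain c where c: "c > 0" "\<And>q. ennreal (c * ln (1 + (norm (q - \<sigma> 0))\<^sup>2)) \<le> ?D (\<sigma> 0) q"
      using minimal_edist_ge_log[OF \<Omega> no] by metis
    have "\<sigma> n \<in> cball (\<sigma> 0) (sqrt (exp (K / c)))" for n
    proof -
      have "c * ln (1 + (norm (\<sigma> n - \<sigma> 0))\<^sup>2) \<le> K"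
        using d_ge[OF in\<Omega> in\<Omega> c(2)] K order_trans by blast
      then have "ln (1 + (norm (\<sigma> n - \<sigma> 0))\<^sup>2) \<le> K / c" using c(1) by (simp add: field_simps)
      then have "1 + (norm (\<sigma> n - \<sigma> 0))\<^sup>2 \<le> exp (K / c)"
        by (smt (verit) exp_le_cancel_iff exp_ln zero_le_power2)
      then have "(norm (\<sigma> n - \<sigma> 0))\<^sup>2 \<le> exp (K / c)" by simp
      then have "norm (\<sigma> n - \<sigma> 0) \<le> sqrt (exp (K / c))" by (rule real_le_rsqrt)
      then show ?thesis by (simp add: dist_norm norm_minus_commute)
    qed
    then obtain l \<rho> where \<rho>: "strict_mono (\<rho> :: nat \<Rightarrow> nat)" "(\<sigma> \<circ> \<rho>) \<longlonglongrightarrow> l"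
      using compact_cball[of "\<sigma> 0" "sqrt (exp (K / c))"] unfolding compact_def by metis
    have l: "l \<in> \<Omega>"
    proof (rule ccontr)
      assume "l \<notin> \<Omega>"
      then obtain a where a: "\<And>y. y \<in> \<Omega> \<Longrightarrow> a \<bullet> y < a \<bullet> l"
        using open_convex_separate_point[OF \<Omega>] by metis
      let ?\<delta> = "\<lambda>x. a \<bullet> l - a \<bullet> x"
      have ab: "bounded_above_on \<Omega> a (a \<bullet> l)" using a by (simp add: bounded_above_on_def)
      have "(\<lambda>n. ?\<delta> ((\<sigma> \<circ> \<rho>) n)) \<longlonglongrightarrow> ?\<delta> l" by (intro tendsto_intros \<rho>(2))
      then have lim: "(\<lambda>n. ?\<delta> (\<sigma> (\<rho> n))) \<longlonglongrightarrow> 0" by simp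
      \<comment> \<open>Where \<open>a \<bullet> l - a \<bullet> x < \<epsilon>\<close>, the half space bound for the distance from \<open>\<sigma> 0\<close> exceeds \<open>K\<close>.\<close>
      define \<epsilon> where "\<epsilon> = exp (ln (?\<delta> (\<sigma> 0)) - 2 * (K + 1))"
      have "\<epsilon> > 0" by (simp add: \<epsilon>_def)
      then have "eventually (\<lambda>n. ?\<delta> (\<sigma> (\<rho> n)) < \<epsilon>) sequentially" by (rule order_tendstoD(2)[OF lim])
      then obtain n where n: "?\<delta> (\<sigma> (\<rho> n)) < \<epsilon>" by (auto simp: eventually_sequentially)
      have "?\<delta> (\<sigma> (\<rho> n)) > 0" using a[OF in\<Omega>] by simp
      then have "ln (?\<delta> (\<sigma> (\<rho> n))) < ln \<epsilon>" using n \<open>\<epsilon> > 0\<close> by (simp only: ln_less_cancel_iff)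
      then have "ln (?\<delta> (\<sigma> (\<rho> n))) < ln (?\<delta> (\<sigma> 0)) - 2 * (K + 1)" by (simp add: \<epsilon>_def)
      moreover have "\<bar>ln (?\<delta> (\<sigma> (\<rho> n))) - ln (?\<delta> (\<sigma> 0))\<bar> / 2 \<le> ?d (\<sigma> 0) (\<sigma> (\<rho> n))"
        by (rule d_ge[OF in\<Omega> in\<Omega> minimal_edist_ge_halfspace[OF ab]])
      ultimately show False
        using K[of "\<rho> n"] abs_ge_minus_self[of "ln (?\<delta> (\<sigma> (\<rho> n))) - ln (?\<delta> (\<sigma> 0))"] by argo
    qed
    obtain R where R: "R > 0" "ball l (2 * R) \<subseteq> \<Omega>"
    proof -
      obtain e where "e > 0" "ball l e \<subseteq> \<Omega>" using \<Omega>(1) l openE by blast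
      then show ?thesis using that[of "e / 2"] by simp
    qed
    have near: "?d l x \<le> norm (x - l) / R" if x: "x \<in> ball l R" for x
    proof (rule d_le)
      have seg: "closed_segment l x \<subseteq> ball l R" using x R by (intro closed_segment_subset) auto
      have "ball y R \<subseteq> \<Omega>" if y: "y \<in> ball l R" for y
      proof
        fix z assume "z \<in> ball y R"
        then have "dist l z < 2 * R" using dist_triangle[of l z y] y by simp
        then show "z \<in> \<Omega>" using R(2) by auto
      qed
      then have balls: "ball y R \<subseteq> \<Omega>" if "y \<in> closed_segment l x" for y using seg that by blast
      have "closed_segment l x \<subseteq> \<Omega>"
        using balls R(1) by (meson centre_in_ball subset_iff)
      then show "?D l x \<le> ennreal (norm (x - l) / R)"
        using R(1) balls by (intro minimal_edist_segment_le minimal_metric_le_norm[OF dim]) auto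
    qed (use R in simp)
    have "limitin mtopology (\<sigma> \<circ> \<rho>) l sequentially"
      unfolding limit_metric_sequentially
    proof (intro conjI allI impI l)
      fix e :: real assume e: "e > 0"
      have "eventually (\<lambda>n. dist ((\<sigma> \<circ> \<rho>) n) l < min R (e * R)) sequentially"
        using e R(1) by (intro tendstoD[OF \<rho>(2)]) auto
      then obtain N where N: "\<And>n. n \<ge> N \<Longrightarrow> dist (\<sigma> (\<rho> n)) l < min R (e * R)"
        by (auto simp: eventually_sequentially)
      have "?d ((\<sigma> \<circ> \<rho>) n) l < e" if "n \<ge> N" for n
      proof -
        have "?d l (\<sigma> (\<rho> n)) \<le> norm (\<sigma> (\<rho> n) - l) / R"
          using N[OF that] by (intro near) (simp add: dist_commute)
        also have "\<dots> < e" using N[OF that] R(1) by (simp add: dist_norm field_simps)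
        finally show ?thesis by (simp add: commute)
      qed
      then show "\<exists>N. \<forall>n\<ge>N. (\<sigma> \<circ> \<rho>) n \<in> \<Omega> \<and> ?d ((\<sigma> \<circ> \<rho>) n) l < e" using in\<Omega> by auto
    qed
    then show "\<exists>x. limitin mtopology \<sigma> x sequentially"
      using MCauchy_convergent_subsequence[OF \<sigma> \<rho>(1)] by blast
  qed
  then show ?thesis using Metric_space_axioms by (simp add: complete_hyperbolic_def)
qed

lemma no_plane_imp_no_parabolic_minimal_surface:
  fixes \<Omega> :: "'a::euclidean_space set"
  assumes \<Omega>: "open \<Omega>" "convex \<Omega>" "\<Omega> \<noteq> {}"
    and no: "\<not> (\<exists>P. affine P \<and> aff_dim P = 2 \<and> P \<subseteq> \<Omega>)"
  shows "no_parabolic_minimal_surface TYPE('s) \<Omega>"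
  unfolding no_parabolic_minimal_surface_def
proof (intro allI impI, elim conjE)
  fix X :: "'s topology" and A and F :: "'s \<Rightarrow> 'a"
  assume X: "parabolic_surface X A" and F: "conformal_harmonic_surface A F" and sub: "F ` topspace X \<subseteq> \<Omega>"
  show "F constant_on topspace X"
  proof (rule parabolic_map_constant[OF X F, of "{a. \<exists>b. bounded_above_on \<Omega> a b}"])
    fix a assume "a \<in> {a. \<exists>b. bounded_above_on \<Omega> a b}"
    then obtain b where b: "bounded_above_on \<Omega> a b" by blast
    show "(\<lambda>x. a \<bullet> F x) constant_on topspace X"
      by (rule parabolic_bounded_functional_constant[OF X F, of _ b])
        (use b sub in \<open>auto simp: bounded_above_on_def\<close>)
  next
    fix v w :: 'a
    assume "v \<bullet> w = 0" "norm v = norm w" "\<forall>a\<in>{a. \<exists>b. bounded_above_on \<Omega> a b}. a \<bullet> v = 0 \<and> a \<bullet> w = 0"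
    then show "v = 0" by (intro conformal_pair_orthogonal_to_bounded_functionals[OF \<Omega> no]) auto
  qed
qed

theorem proposition4p4:
  fixes \<Omega> :: "(real ^ 'n) set"
  assumes "CARD('n) \<ge> 3"
    and "open \<Omega>" and "connected \<Omega>" and "\<Omega> \<noteq> {}" and "convex \<Omega>"
    and "\<exists>e :: complex \<Rightarrow> 's. inj e"
  shows "(complete_hyperbolic \<Omega> \<longleftrightarrow> hyperbolic \<Omega>) \<and>
    (hyperbolic \<Omega> \<longleftrightarrow> weakly_hyperbolic \<Omega>) \<and>
    (weakly_hyperbolic \<Omega> \<longleftrightarrow> \<not> (\<exists>P. affine P \<and> aff_dim P = 2 \<and> P \<subseteq> \<Omega>)) \<and>
    (\<not> (\<exists>P. affine P \<and> aff_dim P = 2 \<and> P \<subseteq> \<Omega>) \<longleftrightarrow>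
      no_parabolic_minimal_surface TYPE('s) \<Omega>)"
proof -
  let ?no = "\<not> (\<exists>P. affine P \<and> aff_dim P = 2 \<and> P \<subseteq> \<Omega>)"
  have dim: "DIM(real ^ 'n) \<ge> 2" using assms(1) by simp
  have "complete_hyperbolic \<Omega> \<Longrightarrow> hyperbolic \<Omega>" by (simp add: complete_hyperbolic_def hyperbolic_def)
  moreover have "hyperbolic \<Omega> \<Longrightarrow> ?no" using plane_imp_not_hyperbolic by blast
  moreover have "?no \<Longrightarrow> complete_hyperbolic \<Omega>"
    by (rule no_plane_imp_complete_hyperbolic[OF dim assms(2,5,4)])
  moreover have "?no \<Longrightarrow> no_parabolic_minimal_surface TYPE('s) \<Omega>"
    by (rule no_plane_imp_no_parabolic_minimal_surface[OF assms(2,5,4)])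
  moreover have "no_parabolic_minimal_surface TYPE('s) \<Omega> \<Longrightarrow> weakly_hyperbolic \<Omega>"
    by (rule no_parabolic_minimal_surface_imp_weakly_hyperbolic[OF assms(6)])
  moreover have "weakly_hyperbolic \<Omega> \<Longrightarrow> ?no" using plane_imp_not_weakly_hyperbolic by blast
  ultimately show ?thesis by blast
qed

end
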